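(* There exists an associative ring $S$ (with unit) for which all of the following hold: (a) there is a bounded above acyclic complex of injective right $S$-modules that is not contractible; (b) there is a bounded below acyclic complex of flat left $S$-modules that is not pure acyclic; (c) there is a bounded below acyclic complex of (finitely generated) projective left $S$-modules that is not contractible.
   Context: Complexes $C^\bullet=(C^n,\ d_n\colon C^n\to C^{n+1})_{n\in\mathbb Z}$ are cohomologically graded (the differential raises the degree). A complex $C^\bullet$ is bounded above if $C^n=0$ for all sufficiently large $n$, and bounded below if $C^n=0$ for all sufficiently small (very negative) $n$. A complex is contractible if its identity endomorphism is homotopic to zero. An acyclic complex of flat modules is called pure acyclic if its modules of cocycles are flat. In (c), the terms of the complex can be taken to be finitely generated projective modules. *)

theory Defs
  imports "HOL-Algebra.Module" "HOL-Algebra.Free_Abelian_Groups"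
begin

section \<open>Modules over associative unital rings\<close>

text \<open>The library locale \<open>module\<close> requires a commutative base ring, so the noncommutative
  version is introduced here, on the same record type.\<close>

locale left_module = R?: ring R + M?: abelian_group M
  for R (structure) and M :: "('a, 'b, 'n) module_scheme" (structure) +
  assumes smult_closed [simp, intro]:
      "\<lbrakk>a \<in> carrier R; x \<in> carrier M\<rbrakk> \<Longrightarrow> a \<odot>\<^bsub>M\<^esub> x \<in> carrier M"
    and smult_l_distr:
      "\<lbrakk>a \<in> carrier R; b \<in> carrier R; x \<in> carrier M\<rbrakk> \<Longrightarrow>
      (a \<oplus>\<^bsub>R\<^esub> b) \<odot>\<^bsub>M\<^esub> x = a \<odot>\<^bsub>M\<^esub> x \<oplus>\<^bsub>M\<^esub> b \<odot>\<^bsub>M\<^esub> x"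
    and smult_r_distr:
      "\<lbrakk>a \<in> carrier R; x \<in> carrier M; y \<in> carrier M\<rbrakk> \<Longrightarrow>
      a \<odot>\<^bsub>M\<^esub> (x \<oplus>\<^bsub>M\<^esub> y) = a \<odot>\<^bsub>M\<^esub> x \<oplus>\<^bsub>M\<^esub> a \<odot>\<^bsub>M\<^esub> y"
    and smult_assoc1:
      "\<lbrakk>a \<in> carrier R; b \<in> carrier R; x \<in> carrier M\<rbrakk> \<Longrightarrow>
      (a \<otimes>\<^bsub>R\<^esub> b) \<odot>\<^bsub>M\<^esub> x = a \<odot>\<^bsub>M\<^esub> (b \<odot>\<^bsub>M\<^esub> x)"
    and smult_one [simp]:
      "x \<in> carrier M \<Longrightarrow> \<one>\<^bsub>R\<^esub> \<odot>\<^bsub>M\<^esub> x = x"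

text \<open>Right \<open>R\<close>-modules are left modules over the opposite ring; \<open>r \<odot> x\<close> then stands for
  what is usually written \<open>x r\<close>.\<close>

definition opposite_ring :: "('a, 'm) ring_scheme \<Rightarrow> ('a, 'm) ring_scheme"
  where "opposite_ring R = R\<lparr>mult := \<lambda>x y. y \<otimes>\<^bsub>R\<^esub> x\<rparr>"

abbreviation right_module :: "('a, 'm) ring_scheme \<Rightarrow> ('a, 'b, 'n) module_scheme \<Rightarrow> bool"
  where "right_module R M \<equiv> left_module (opposite_ring R) M"

definition left_module_hom ::
    "('a, 'm) ring_scheme \<Rightarrow> ('a, 'b, 'n) module_scheme \<Rightarrow> ('a, 'c, 'o) module_scheme \<Rightarrow> ('b \<Rightarrow> 'c) set"
  where "left_module_hom R M N = {f \<in> carrier M \<rightarrow> carrier N.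
    (\<forall>x \<in> carrier M. \<forall>y \<in> carrier M. f (x \<oplus>\<^bsub>M\<^esub> y) = f x \<oplus>\<^bsub>N\<^esub> f y) \<and>
    (\<forall>r \<in> carrier R. \<forall>x \<in> carrier M. f (r \<odot>\<^bsub>M\<^esub> x) = r \<odot>\<^bsub>N\<^esub> f x)}"

definition finitely_generated :: "('a, 'm) ring_scheme \<Rightarrow> ('a, 'b) module \<Rightarrow> bool"
  where "finitely_generated R M \<longleftrightarrow> left_module R M \<and>
    (\<exists>Y. finite Y \<and> Y \<subseteq> carrier M \<and> (\<forall>N. submodule N R M \<and> Y \<subseteq> N \<longrightarrow> N = carrier M))"


section \<open>Injective, projective and flat modules\<close>

text \<open>Injectivity, projectivity and flatness of a module quantify over all modules, whereas a HOL
  formula cannot quantify over types. The test modules below have their elements in the following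
  type, where \<open>'a\<close> is the type of the ring and \<open>'b\<close> the type of the module under consideration.
  This is no restriction: by the theorems \<open>injective_module_extend\<close>, \<open>projective_module_lift\<close> and
  \<open>flat_module_inj\<close> at the end of this theory, the defining property then holds for test modules
  with elements in arbitrary types.\<close>

type_synonym ('a, 'b) test = "('a \<times> 'b \<times> nat) list set"

definition injective_module :: "('a, 'm) ring_scheme \<Rightarrow> ('a, 'b) module \<Rightarrow> bool"
  where "injective_module R I \<longleftrightarrow> left_module R I \<and>
    (\<forall>(A :: ('a, ('a, 'b) test) module) (B :: ('a, ('a, 'b) test) module) i g.
      left_module R A \<and> left_module R B \<and>
      i \<in> left_module_hom R A B \<and> inj_on i (carrier A) \<and> g \<in> left_module_hom R A I \<longrightarrow>
      (\<exists>h \<in> left_module_hom R B I. \<forall>x \<in> carrier A. h (i x) = g x))"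

definition projective_module :: "('a, 'm) ring_scheme \<Rightarrow> ('a, 'b) module \<Rightarrow> bool"
  where "projective_module R P \<longleftrightarrow> left_module R P \<and>
    (\<forall>(B :: ('a, ('a, 'b) test) module) (C :: ('a, ('a, 'b) test) module) p g.
      left_module R B \<and> left_module R C \<and>
      p \<in> left_module_hom R B C \<and> p ` carrier B = carrier C \<and> g \<in> left_module_hom R P C \<longrightarrow>
      (\<exists>h \<in> left_module_hom R P B. \<forall>x \<in> carrier P. p (h x) = g x))"

text \<open>The tensor product of a right module \<open>A\<close> and a left module \<open>F\<close> over \<open>R\<close>, as the quotient
  of the free abelian group on pairs by the bilinearity and balancing relations.\<close>

definition tensor_relations ::
    "('a, 'm) ring_scheme \<Rightarrow> ('a, 'c) module \<Rightarrow> ('a, 'b) module \<Rightarrow> ('c \<times> 'b \<Rightarrow>\<^sub>0 int) set"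
  where "tensor_relations R A F =
    {frag_of (a \<oplus>\<^bsub>A\<^esub> a', x) - frag_of (a, x) - frag_of (a', x) | a a' x.
      a \<in> carrier A \<and> a' \<in> carrier A \<and> x \<in> carrier F} \<union>
    {frag_of (a, x \<oplus>\<^bsub>F\<^esub> x') - frag_of (a, x) - frag_of (a, x') | a x x'.
      a \<in> carrier A \<and> x \<in> carrier F \<and> x' \<in> carrier F} \<union>
    {frag_of (r \<odot>\<^bsub>A\<^esub> a, x) - frag_of (a, r \<odot>\<^bsub>F\<^esub> x) | r a x.
      r \<in> carrier R \<and> a \<in> carrier A \<and> x \<in> carrier F}"

definition tensor_null ::
    "('a, 'm) ring_scheme \<Rightarrow> ('a, 'c) module \<Rightarrow> ('a, 'b) module \<Rightarrow> ('c \<times> 'b \<Rightarrow>\<^sub>0 int) set"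
  where "tensor_null R A F =
    generate (free_Abelian_group (carrier A \<times> carrier F)) (tensor_relations R A F)"

definition tensor_product ::
    "('a, 'm) ring_scheme \<Rightarrow> ('a, 'c) module \<Rightarrow> ('a, 'b) module \<Rightarrow> ('c \<times> 'b \<Rightarrow>\<^sub>0 int) set monoid"
  where "tensor_product R A F =
    free_Abelian_group (carrier A \<times> carrier F) Mod tensor_null R A F"

text \<open>The homomorphism of free abelian groups that applies \<open>f\<close> to the first component of each
  pair, and the map \<open>A \<otimes> F \<rightarrow> B \<otimes> F\<close> that it induces on cosets if \<open>f : A \<rightarrow> B\<close> is a
  homomorphism.\<close>

definition frag_fst :: "('c \<Rightarrow> 'd) \<Rightarrow> ('c \<times> 'b \<Rightarrow>\<^sub>0 int) \<Rightarrow> ('d \<times> 'b \<Rightarrow>\<^sub>0 int)"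
  where "frag_fst f = frag_extend (\<lambda>(a, x). frag_of (f a, x))"

definition tensor_map ::
    "('a, 'm) ring_scheme \<Rightarrow> ('a, 'd) module \<Rightarrow> ('a, 'b) module \<Rightarrow> ('c \<Rightarrow> 'd) \<Rightarrow>
      ('c \<times> 'b \<Rightarrow>\<^sub>0 int) set \<Rightarrow> ('d \<times> 'b \<Rightarrow>\<^sub>0 int) set"
  where "tensor_map R B F f X =
    the_elem ((\<lambda>u. tensor_null R B F #>\<^bsub>free_Abelian_group (carrier B \<times> carrier F)\<^esub> frag_fst f u) ` X)"

definition flat_module :: "('a, 'm) ring_scheme \<Rightarrow> ('a, 'b) module \<Rightarrow> bool"
  where "flat_module R F \<longleftrightarrow> left_module R F \<and>
    (\<forall>(A :: ('a, ('a, 'b) test) module) (B :: ('a, ('a, 'b) test) module) i.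
      right_module R A \<and> right_module R B \<and>
      i \<in> left_module_hom (opposite_ring R) A B \<and> inj_on i (carrier A) \<longrightarrow>
      inj_on (tensor_map R B F i) (carrier (tensor_product R A F)))"


section \<open>Complexes\<close>

definition cochain_complex ::
    "('a, 'm) ring_scheme \<Rightarrow> (int \<Rightarrow> ('a, 'b) module) \<Rightarrow> (int \<Rightarrow> 'b \<Rightarrow> 'b) \<Rightarrow> bool"
  where "cochain_complex R C d \<longleftrightarrow> (\<forall>n. left_module R (C n)) \<and>
    (\<forall>n. d n \<in> left_module_hom R (C n) (C (n + 1))) \<and>
    (\<forall>n. \<forall>x \<in> carrier (C n). d (n + 1) (d n x) = \<zero>\<^bsub>C (n + 1 + 1)\<^esub>)"

definition bounded_above :: "(int \<Rightarrow> ('a, 'b) module) \<Rightarrow> bool"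
  where "bounded_above C \<longleftrightarrow> (\<exists>N. \<forall>n > N. carrier (C n) = {\<zero>\<^bsub>C n\<^esub>})"

definition bounded_below :: "(int \<Rightarrow> ('a, 'b) module) \<Rightarrow> bool"
  where "bounded_below C \<longleftrightarrow> (\<exists>N. \<forall>n < N. carrier (C n) = {\<zero>\<^bsub>C n\<^esub>})"

definition cocycles ::
    "(int \<Rightarrow> ('a, 'b) module) \<Rightarrow> (int \<Rightarrow> 'b \<Rightarrow> 'b) \<Rightarrow> int \<Rightarrow> ('a, 'b) module"
  where "cocycles C d n = (C n)\<lparr>carrier := {x \<in> carrier (C n). d n x = \<zero>\<^bsub>C (n + 1)\<^esub>}\<rparr>"

definition acyclic_complex ::
    "('a, 'm) ring_scheme \<Rightarrow> (int \<Rightarrow> ('a, 'b) module) \<Rightarrow> (int \<Rightarrow> 'b \<Rightarrow> 'b) \<Rightarrow> bool"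
  where "acyclic_complex R C d \<longleftrightarrow> cochain_complex R C d \<and>
    (\<forall>n. carrier (cocycles C d n) = d (n - 1) ` carrier (C (n - 1)))"

text \<open>Homotopy of two morphisms of complexes \<open>f\<close>, \<open>g\<close> from \<open>(C, d)\<close> to \<open>(D, e)\<close>.\<close>

definition chain_homotopic ::
    "('a, 'm) ring_scheme \<Rightarrow> (int \<Rightarrow> ('a, 'b) module) \<Rightarrow> (int \<Rightarrow> 'b \<Rightarrow> 'b) \<Rightarrow>
      (int \<Rightarrow> ('a, 'c) module) \<Rightarrow> (int \<Rightarrow> 'c \<Rightarrow> 'c) \<Rightarrow>
      (int \<Rightarrow> 'b \<Rightarrow> 'c) \<Rightarrow> (int \<Rightarrow> 'b \<Rightarrow> 'c) \<Rightarrow> bool"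
  where "chain_homotopic R C d D e f g \<longleftrightarrow>
    (\<exists>h. (\<forall>n. h n \<in> left_module_hom R (C n) (D (n - 1))) \<and>
      (\<forall>n. \<forall>x \<in> carrier (C n).
        f n x \<ominus>\<^bsub>D n\<^esub> g n x = e (n - 1) (h n x) \<oplus>\<^bsub>D n\<^esub> h (n + 1) (d n x)))"

definition contractible_complex ::
    "('a, 'm) ring_scheme \<Rightarrow> (int \<Rightarrow> ('a, 'b) module) \<Rightarrow> (int \<Rightarrow> 'b \<Rightarrow> 'b) \<Rightarrow> bool"
  where "contractible_complex R C d \<longleftrightarrow> cochain_complex R C d \<and>
    chain_homotopic R C d C d (\<lambda>n x. x) (\<lambda>n x. \<zero>\<^bsub>C n\<^esub>)"

definition pure_acyclic_complex ::
    "('a, 'm) ring_scheme \<Rightarrow> (int \<Rightarrow> ('a, 'b) module) \<Rightarrow> (int \<Rightarrow> 'b \<Rightarrow> 'b) \<Rightarrow> bool"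
  where "pure_acyclic_complex R C d \<longleftrightarrow> acyclic_complex R C d \<and>
    (\<forall>n. flat_module R (C n)) \<and> (\<forall>n. flat_module R (cocycles C d n))"


section \<open>The test modules suffice\<close>

lemma left_module_smult_l_null:
  assumes "left_module R M" "x \<in> carrier M"
  shows "\<zero>\<^bsub>R\<^esub> \<odot>\<^bsub>M\<^esub> x = \<zero>\<^bsub>M\<^esub>"
proof -
  interpret left_module R M by fact
  have "\<zero>\<^bsub>R\<^esub> \<odot>\<^bsub>M\<^esub> x \<oplus>\<^bsub>M\<^esub> \<zero>\<^bsub>R\<^esub> \<odot>\<^bsub>M\<^esub> x = \<zero>\<^bsub>R\<^esub> \<odot>\<^bsub>M\<^esub> x"
    using assms(2) smult_l_distr[of "\<zero>\<^bsub>R\<^esub>" "\<zero>\<^bsub>R\<^esub>" x] by simp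
  then show ?thesis
    using assms(2) M.add.l_cancel_one[of "\<zero>\<^bsub>R\<^esub> \<odot>\<^bsub>M\<^esub> x" "\<zero>\<^bsub>R\<^esub> \<odot>\<^bsub>M\<^esub> x"] by simp
qed

lemma left_module_minus_one:
  assumes "left_module R M" "x \<in> carrier M"
  shows "(\<ominus>\<^bsub>R\<^esub> \<one>\<^bsub>R\<^esub>) \<odot>\<^bsub>M\<^esub> x = \<ominus>\<^bsub>M\<^esub> x"
proof -
  interpret left_module R M by fact
  have "(\<ominus>\<^bsub>R\<^esub> \<one>\<^bsub>R\<^esub>) \<odot>\<^bsub>M\<^esub> x \<oplus>\<^bsub>M\<^esub> x = (\<ominus>\<^bsub>R\<^esub> \<one>\<^bsub>R\<^esub> \<oplus>\<^bsub>R\<^esub> \<one>\<^bsub>R\<^esub>) \<odot>\<^bsub>M\<^esub> x"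
    using assms(2) by (subst smult_l_distr) auto
  also have "\<dots> = \<zero>\<^bsub>M\<^esub>" using left_module_smult_l_null[OF assms] by (simp add: R.l_neg)
  finally show ?thesis using assms(2) by (simp add: M.minus_equality)
qed

lemma submodule_of_left_moduleI:
  assumes "left_module R M" "H \<subseteq> carrier M" "\<zero>\<^bsub>M\<^esub> \<in> H"
    and add: "\<And>x y. x \<in> H \<Longrightarrow> y \<in> H \<Longrightarrow> x \<oplus>\<^bsub>M\<^esub> y \<in> H"
    and smult: "\<And>r x. r \<in> carrier R \<Longrightarrow> x \<in> H \<Longrightarrow> r \<odot>\<^bsub>M\<^esub> x \<in> H"
  shows "submodule H R M"
proof -
  interpret left_module R M by fact
  have neg: "\<ominus>\<^bsub>M\<^esub> x \<in> H" if "x \<in> H" for x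
    using smult[OF _ that, of "\<ominus>\<^bsub>R\<^esub> \<one>\<^bsub>R\<^esub>"] left_module_minus_one[OF assms(1), of x]
      that assms(2) by auto
  show ?thesis
    unfolding submodule_def submodule_axioms_def subgroup_def
    using assms neg by (auto simp: a_inv_def)
qed

lemma submodule_facts:
  assumes "submodule H R M"
  shows "H \<subseteq> carrier M" "\<zero>\<^bsub>M\<^esub> \<in> H" "\<And>x y. x \<in> H \<Longrightarrow> y \<in> H \<Longrightarrow> x \<oplus>\<^bsub>M\<^esub> y \<in> H"
    "\<And>x. x \<in> H \<Longrightarrow> \<ominus>\<^bsub>M\<^esub> x \<in> H" "\<And>r x. r \<in> carrier R \<Longrightarrow> x \<in> H \<Longrightarrow> r \<odot>\<^bsub>M\<^esub> x \<in> H"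
  using assms unfolding submodule_def submodule_axioms_def subgroup_def
  by (auto simp: a_inv_def)

lemma left_module_hom_facts:
  assumes "f \<in> left_module_hom R M N"
  shows "\<And>x. x \<in> carrier M \<Longrightarrow> f x \<in> carrier N"
    "\<And>x y. x \<in> carrier M \<Longrightarrow> y \<in> carrier M \<Longrightarrow> f (x \<oplus>\<^bsub>M\<^esub> y) = f x \<oplus>\<^bsub>N\<^esub> f y"
    "\<And>r x. r \<in> carrier R \<Longrightarrow> x \<in> carrier M \<Longrightarrow> f (r \<odot>\<^bsub>M\<^esub> x) = r \<odot>\<^bsub>N\<^esub> f x"
  using assms unfolding left_module_hom_def by auto

lemma left_module_hom_zero:
  assumes "left_module R M" "left_module R N" "f \<in> left_module_hom R M N"
  shows "f \<zero>\<^bsub>M\<^esub> = \<zero>\<^bsub>N\<^esub>"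
proof -
  interpret M: left_module R M by fact
  interpret N: left_module R N by fact
  have "f \<zero>\<^bsub>M\<^esub> \<oplus>\<^bsub>N\<^esub> f \<zero>\<^bsub>M\<^esub> = f \<zero>\<^bsub>M\<^esub>"
    using left_module_hom_facts(2)[OF assms(3), of "\<zero>\<^bsub>M\<^esub>" "\<zero>\<^bsub>M\<^esub>"] by simp
  then show ?thesis using left_module_hom_facts(1)[OF assms(3), of "\<zero>\<^bsub>M\<^esub>"]
      N.M.add.l_cancel_one[of "f \<zero>\<^bsub>M\<^esub>" "f \<zero>\<^bsub>M\<^esub>"] by simp
qed

lemma left_module_hom_comp:
  assumes "f \<in> left_module_hom R M N" "g \<in> left_module_hom R N K"
  shows "(\<lambda>x. g (f x)) \<in> left_module_hom R M K"
  using assms unfolding left_module_hom_def by (auto simp: Pi_def)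

lemma left_module_transport:
  fixes M :: "('a, 'b, 'n) module_scheme" and c :: "'b \<Rightarrow> 'c"
  assumes M: "left_module R M" and H: "submodule H R M" and c: "inj_on c H"
  obtains N :: "('a, 'c) module" and e where "left_module R N" "e \<in> left_module_hom R N M"
    "inj_on e (carrier N)" "e ` carrier N = H"
proof -
  interpret left_module R M by fact
  note Hf = submodule_facts[OF H]
  note Hc = subsetD[OF Hf(1)]
  let ?e = "inv_into H c"
  define N :: "('a, 'c) module" where "N = \<lparr>carrier = c ` H, mult = (\<lambda>x y. x), one = c \<zero>\<^bsub>M\<^esub>,
    ring.zero = c \<zero>\<^bsub>M\<^esub>, ring.add = (\<lambda>x y. c (?e x \<oplus>\<^bsub>M\<^esub> ?e y)), smult = (\<lambda>r x. c (r \<odot>\<^bsub>M\<^esub> ?e x))\<rparr>"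
  have [simp]: "?e (c x) = x" if "x \<in> H" for x using c that by simp
  have N: "left_module R N"
  proof (intro left_module.intro left_module_axioms.intro)
    show "ring R" by (rule R.ring_axioms)
    show "abelian_group N"
    proof (rule abelian_groupI)
      show "\<exists>y\<in>carrier N. y \<oplus>\<^bsub>N\<^esub> x = \<zero>\<^bsub>N\<^esub>" if "x \<in> carrier N" for x
      proof -
        from that obtain h where h: "h \<in> H" "x = c h" by (auto simp: N_def)
        have "c (\<ominus>\<^bsub>M\<^esub> h) \<oplus>\<^bsub>N\<^esub> x = \<zero>\<^bsub>N\<^esub>" using h Hf Hc by (simp add: N_def M.l_neg)
        then show ?thesis using h Hf(4) by (auto simp: N_def)
      qed
    qed (auto simp: N_def Hf Hc M.a_ac)
  qed (auto simp: N_def Hf Hc smult_l_distr smult_r_distr smult_assoc1)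
  show ?thesis
  proof (rule that[OF N])
    show "?e \<in> left_module_hom R N M"
      by (auto simp: left_module_hom_def N_def Hf Hc)
    show "inj_on ?e (carrier N)" by (simp add: N_def inj_on_inv_into)
    show "?e ` carrier N = H" using c by (simp add: N_def)
  qed
qed

lemma left_module_hom_factor:
  assumes N: "left_module R N" and X: "left_module R X"
    and e: "e \<in> left_module_hom R N M" "inj_on e (carrier N)"
    and f: "f \<in> left_module_hom R X M" "f ` carrier X \<subseteq> e ` carrier N"
  obtains f' where "f' \<in> left_module_hom R X N" "\<forall>x \<in> carrier X. e (f' x) = f x"
proof -
  interpret N: left_module R N by fact
  interpret X: left_module R X by fact
  let ?f' = "\<lambda>x. inv_into (carrier N) e (f x)"
  have ef: "e (?f' x) = f x" and cl: "?f' x \<in> carrier N" if "x \<in> carrier X" for x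
    using f(2) that by (auto intro!: f_inv_into_f inv_into_into)
  have "?f' \<in> left_module_hom R X N"
    unfolding left_module_hom_def
  proof (intro CollectI conjI ballI)
    show "?f' \<in> carrier X \<rightarrow> carrier N" using cl by auto
    fix x assume x: "x \<in> carrier X"
    { fix y assume y: "y \<in> carrier X"
      have "e (?f' (x \<oplus>\<^bsub>X\<^esub> y)) = e (?f' x \<oplus>\<^bsub>N\<^esub> ?f' y)"
        using x y cl ef[of "x \<oplus>\<^bsub>X\<^esub> y"] ef[OF x] ef[OF y] left_module_hom_facts(2)[OF f(1) x y]
        by (simp only: left_module_hom_facts(2)[OF e(1)] X.M.a_closed)
      then show "?f' (x \<oplus>\<^bsub>X\<^esub> y) = ?f' x \<oplus>\<^bsub>N\<^esub> ?f' y"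
        using e(2) x y cl by (meson N.M.a_closed X.M.a_closed inj_on_eq_iff) }
    { fix r assume r: "r \<in> carrier R"
      have "e (?f' (r \<odot>\<^bsub>X\<^esub> x)) = e (r \<odot>\<^bsub>N\<^esub> ?f' x)"
        using x r cl ef[of "r \<odot>\<^bsub>X\<^esub> x"] ef[OF x] left_module_hom_facts(3)[OF f(1) r x]
        by (simp only: left_module_hom_facts(3)[OF e(1)] X.smult_closed)
      then show "?f' (r \<odot>\<^bsub>X\<^esub> x) = r \<odot>\<^bsub>N\<^esub> ?f' x"
        using e(2) x r cl by (meson N.smult_closed X.smult_closed inj_on_eq_iff) }
  qed
  then show ?thesis using that ef by blast
qed

text \<open>A submodule generated by a family indexed by \<open>'i\<close> has a copy in the type
  \<open>('a \<times> 'i) list set\<close>: an element is encoded as the set of formal combinations representing it.\<close>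

definition lincomb :: "('a, 'b, 'n) module_scheme \<Rightarrow> ('i \<Rightarrow> 'b) \<Rightarrow> ('a \<times> 'i) list \<Rightarrow> 'b"
  where "lincomb M y l = foldr (\<lambda>(r, i) v. r \<odot>\<^bsub>M\<^esub> y i \<oplus>\<^bsub>M\<^esub> v) l \<zero>\<^bsub>M\<^esub>"

lemma left_module_small_copy:
  fixes M :: "('a, 'b, 'n) module_scheme" and y :: "'i \<Rightarrow> 'b"
  assumes M: "left_module R M" and y: "range y \<subseteq> carrier M"
  obtains N :: "('a, ('a \<times> 'i) list set) module" and e where "left_module R N"
    "e \<in> left_module_hom R N M" "inj_on e (carrier N)" "range y \<subseteq> e ` carrier N"
    "submodule (e ` carrier N) R M"
proof -
  interpret left_module R M by fact
  define L :: "('a \<times> 'i) list set" where "L = {l. fst ` set l \<subseteq> carrier R}"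
  let ?ev = "lincomb M y"
  define H where "H = ?ev ` L"
  have y': "y i \<in> carrier M" for i using y by auto
  have ev_simps: "?ev [] = \<zero>\<^bsub>M\<^esub>" "?ev ((r, i) # l) = r \<odot>\<^bsub>M\<^esub> y i \<oplus>\<^bsub>M\<^esub> ?ev l" for r i l
    by (simp_all add: lincomb_def)
  have cl: "?ev l \<in> carrier M" if "l \<in> L" for l
    using that by (induction l) (auto simp: ev_simps L_def y')
  have app: "?ev (l @ l') = ?ev l \<oplus>\<^bsub>M\<^esub> ?ev l'" if "l \<in> L" "l' \<in> L" for l l'
    using that
  proof (induction l)
    case Nil then show ?case using cl by (simp add: ev_simps)
  next
    case (Cons a l)
    obtain r i where a: "a = (r, i)" by fastforce
    have "r \<in> carrier R" "l \<in> L" using Cons a by (auto simp: L_def)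
    then show ?case using Cons cl y' by (simp add: a ev_simps M.a_assoc)
  qed
  have scal: "map (\<lambda>(s, i). (r \<otimes>\<^bsub>R\<^esub> s, i)) l \<in> L \<and>
      ?ev (map (\<lambda>(s, i). (r \<otimes>\<^bsub>R\<^esub> s, i)) l) = r \<odot>\<^bsub>M\<^esub> ?ev l" if "l \<in> L" "r \<in> carrier R" for l r
    using that
  proof (induction l)
    case Nil
    have "r \<odot>\<^bsub>M\<^esub> \<zero>\<^bsub>M\<^esub> \<oplus>\<^bsub>M\<^esub> r \<odot>\<^bsub>M\<^esub> \<zero>\<^bsub>M\<^esub> = r \<odot>\<^bsub>M\<^esub> \<zero>\<^bsub>M\<^esub>"
      using Nil smult_r_distr[of r "\<zero>\<^bsub>M\<^esub>" "\<zero>\<^bsub>M\<^esub>"] by simp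
    then have "r \<odot>\<^bsub>M\<^esub> \<zero>\<^bsub>M\<^esub> = \<zero>\<^bsub>M\<^esub>" using Nil M.add.l_cancel_one[of "r \<odot>\<^bsub>M\<^esub> \<zero>\<^bsub>M\<^esub>" "r \<odot>\<^bsub>M\<^esub> \<zero>\<^bsub>M\<^esub>"] by simp
    then show ?case by (simp add: ev_simps L_def)
  next
    case (Cons a l)
    obtain s i where a: "a = (s, i)" by fastforce
    have "s \<in> carrier R" "l \<in> L" using Cons a by (auto simp: L_def)
    then show ?case using Cons cl y' by (auto simp add: a ev_simps smult_r_distr smult_assoc1 L_def)
  qed
  have H: "submodule H R M"
  proof (rule submodule_of_left_moduleI[OF M])
    show "H \<subseteq> carrier M" using cl by (auto simp: H_def)
    have "[] \<in> L" by (simp add: L_def)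
    then show "\<zero>\<^bsub>M\<^esub> \<in> H" using ev_simps(1) unfolding H_def by (metis imageI)
    show "x \<oplus>\<^bsub>M\<^esub> z \<in> H" if x: "x \<in> H" and z: "z \<in> H" for x z
    proof -
      obtain l l' where ll: "l \<in> L" "l' \<in> L" "x = ?ev l" "z = ?ev l'" using x z by (auto simp: H_def)
      then have "l @ l' \<in> L" by (auto simp: L_def)
      then show ?thesis using app[OF ll(1,2)] ll unfolding H_def by (metis imageI)
    qed
    show "r \<odot>\<^bsub>M\<^esub> x \<in> H" if r: "r \<in> carrier R" and x: "x \<in> H" for r x
    proof -
      obtain l where l: "l \<in> L" "x = ?ev l" using x by (auto simp: H_def)
      show ?thesis using scal[OF l(1) r] l unfolding H_def by (metis imageI)
    qed
  qed
  have "inj_on (\<lambda>b. {l \<in> L. ?ev l = b}) H"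
    by (rule inj_onI) (auto simp: H_def)
  then obtain N :: "('a, ('a \<times> 'i) list set) module" and e where N: "left_module R N"
    "e \<in> left_module_hom R N M" "inj_on e (carrier N)" "e ` carrier N = H"
    by (rule left_module_transport[OF M H])
  have "y i \<in> H" for i
  proof -
    have "[(\<one>\<^bsub>R\<^esub>, i)] \<in> L" by (simp add: L_def)
    moreover have "?ev [(\<one>\<^bsub>R\<^esub>, i)] = y i" using y' by (simp add: ev_simps)
    ultimately show ?thesis unfolding H_def by (metis imageI)
  qed
  then show ?thesis using N H by (intro that[of N e]) auto
qed

theorem projective_module_lift:
  fixes P :: "('a, 'b) module" and B :: "('a, 'c) module" and C :: "('a, 'd) module"
  assumes P: "projective_module R P" and B: "left_module R B" and C: "left_module R C"
    and p: "p \<in> left_module_hom R B C" "p ` carrier B = carrier C"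
    and g: "g \<in> left_module_hom R P C"
  shows "\<exists>h \<in> left_module_hom R P B. \<forall>x \<in> carrier P. p (h x) = g x"
proof -
  have PM: "left_module R P" using P by (simp add: projective_module_def)
  interpret P: left_module R P by fact
  interpret B: left_module R B by fact
  interpret C: left_module R C by fact
  define y :: "'b \<times> nat \<Rightarrow> 'c" where
    "y = (\<lambda>(x, n). if x \<in> carrier P then inv_into (carrier B) p (g x) else \<zero>\<^bsub>B\<^esub>)"
  have gp: "g x \<in> p ` carrier B" if "x \<in> carrier P" for x
    using p(2) left_module_hom_facts(1)[OF g that] by simp
  have y: "range y \<subseteq> carrier B" by (auto simp: y_def inv_into_into[OF gp])
  obtain N :: "('a, ('a, 'b) test) module" and e where
    N: "left_module R N" and e: "e \<in> left_module_hom R N B" "inj_on e (carrier N)"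
    "range y \<subseteq> e ` carrier N" and "submodule (e ` carrier N) R B"
    by (rule left_module_small_copy[OF B y])
  interpret N: left_module R N by fact
  let ?pe = "\<lambda>x. p (e x)"
  have pe: "?pe \<in> left_module_hom R N C" by (rule left_module_hom_comp[OF e(1) p(1)])
  let ?H = "?pe ` carrier N"
  have H: "submodule ?H R C"
  proof (rule submodule_of_left_moduleI[OF C])
    show "?H \<subseteq> carrier C" using left_module_hom_facts(1)[OF pe] by auto
    show "\<zero>\<^bsub>C\<^esub> \<in> ?H" using left_module_hom_zero[OF N C pe] by (metis N.M.zero_closed imageI)
    show "x \<oplus>\<^bsub>C\<^esub> z \<in> ?H" if "x \<in> ?H" "z \<in> ?H" for x z
      using that by (auto simp: left_module_hom_facts(2)[OF pe, symmetric])
    show "r \<odot>\<^bsub>C\<^esub> x \<in> ?H" if "r \<in> carrier R" "x \<in> ?H" for r x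
      using that by (auto simp: left_module_hom_facts(3)[OF pe, symmetric])
  qed
  obtain K :: "('a, ('a, 'b) test) module" and e' where
    K: "left_module R K" and e': "e' \<in> left_module_hom R K C" "inj_on e' (carrier K)"
    "e' ` carrier K = ?H"
    by (rule left_module_transport[OF C H inj_on_inv_into[OF subset_refl, where f = ?pe and A = "carrier N"]])
  obtain q where q: "q \<in> left_module_hom R N K" "\<forall>x \<in> carrier N. e' (q x) = ?pe x"
    by (rule left_module_hom_factor[OF K N e'(1,2) pe equalityD2[OF e'(3)]])
  have gH: "g x \<in> e' ` carrier K" if "x \<in> carrier P" for x
  proof -
    have "y (x, 0) \<in> e ` carrier N" using e(3) by (rule subsetD) (rule rangeI)
    then obtain n where n: "y (x, 0) = e n" "n \<in> carrier N" by (rule imageE)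
    have "p (y (x, 0)) = g x" using f_inv_into_f[OF gp[OF that]] that by (simp add: y_def)
    then have "g x = ?pe n" using n(1) by simp
    then have "g x \<in> ?H" using n(2) by (rule image_eqI)
    then show ?thesis using e'(3) by simp
  qed
  have gK: "g ` carrier P \<subseteq> e' ` carrier K" using gH by (rule image_subsetI)
  obtain g' where g': "g' \<in> left_module_hom R P K" "\<forall>x \<in> carrier P. e' (g' x) = g x"
    by (rule left_module_hom_factor[OF K PM e'(1,2) g gK])
  have "q ` carrier N = carrier K"
  proof
    show "q ` carrier N \<subseteq> carrier K" using left_module_hom_facts(1)[OF q(1)] by auto
    show "carrier K \<subseteq> q ` carrier N"
    proof
      fix k assume k: "k \<in> carrier K"
      then have "e' k \<in> ?H" using e'(3) by (metis imageI)
      then obtain n where n: "e' k = ?pe n" "n \<in> carrier N" by (rule imageE)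
      have "e' k = e' (q n)" using n bspec[OF q(2) n(2)] by simp
      then have "k = q n" by (rule inj_onD[OF e'(2) _ k left_module_hom_facts(1)[OF q(1) n(2)]])
      then show "k \<in> q ` carrier N" using n(2) by (rule image_eqI)
    qed
  qed
  then have "\<exists>h \<in> left_module_hom R P N. \<forall>x \<in> carrier P. q (h x) = g' x"
    using conjunct2[OF P[unfolded projective_module_def], THEN spec, THEN spec, THEN spec, THEN spec,
        THEN mp, of N K q g'] N K q(1) g'(1) by simp
  then obtain h where h: "h \<in> left_module_hom R P N" "\<And>x. x \<in> carrier P \<Longrightarrow> q (h x) = g' x"
    by blast
  have "p (e (h x)) = g x" if "x \<in> carrier P" for x
    using h(2)[OF that] bspec[OF g'(2) that] bspec[OF q(2) left_module_hom_facts(1)[OF h(1) that]] by simp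
  then show ?thesis using left_module_hom_comp[OF h(1) e(1)] by (intro bexI[of _ "\<lambda>x. e (h x)"]) auto
qed


definition regular_module :: "('a, 'm) ring_scheme \<Rightarrow> ('a, 'a) module"
  where "regular_module R = \<lparr>carrier = carrier R, mult = (\<otimes>\<^bsub>R\<^esub>), one = \<one>\<^bsub>R\<^esub>,
    ring.zero = \<zero>\<^bsub>R\<^esub>, ring.add = (\<oplus>\<^bsub>R\<^esub>), smult = (\<otimes>\<^bsub>R\<^esub>)\<rparr>"

lemma left_module_regular:
  assumes "ring R" shows "left_module R (regular_module R)"
proof -
  interpret R: ring R by fact
  show ?thesis
  proof (intro left_module.intro left_module_axioms.intro)
    show "abelian_group (regular_module R)"
    proof (rule abelian_groupI)
      show "\<exists>y\<in>carrier (regular_module R). y \<oplus>\<^bsub>regular_module R\<^esub> x = \<zero>\<^bsub>regular_module R\<^esub>"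
        if "x \<in> carrier (regular_module R)" for x
        using that by (auto simp: regular_module_def intro!: bexI[of _ "\<ominus>\<^bsub>R\<^esub> x"] R.l_neg)
    qed (auto simp: regular_module_def R.a_ac)
  qed (auto simp: regular_module_def R.l_distr R.r_distr R.m_assoc assms)
qed

text \<open>Baer's criterion: it suffices to extend homomorphisms from left ideals.\<close>

lemma injective_module_ideal:
  fixes I :: "('a, 'b) module" and R :: "('a, 'm) ring_scheme"
  assumes I: "injective_module R I" and J: "submodule J R (regular_module R)"
    and f: "\<And>r. r \<in> J \<Longrightarrow> f r \<in> carrier I"
    "\<And>r s. r \<in> J \<Longrightarrow> s \<in> J \<Longrightarrow> f (r \<oplus>\<^bsub>R\<^esub> s) = f r \<oplus>\<^bsub>I\<^esub> f s"
    "\<And>r s. r \<in> carrier R \<Longrightarrow> s \<in> J \<Longrightarrow> f (r \<otimes>\<^bsub>R\<^esub> s) = r \<odot>\<^bsub>I\<^esub> f s"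
  shows "\<exists>x \<in> carrier I. \<forall>r \<in> J. f r = r \<odot>\<^bsub>I\<^esub> x"
proof -
  have IM: "left_module R I" using I by (simp add: injective_module_def)
  interpret I: left_module R I by fact
  let ?M = "regular_module R"
  have M: "left_module R ?M" by (rule left_module_regular[OF I.R.ring_axioms])
  interpret M: left_module R ?M by fact
  have R: "submodule (carrier ?M) R ?M"
    by (rule submodule_of_left_moduleI[OF M]) auto
  let ?c = "\<lambda>s :: 'a. {[(s, undefined :: 'b, 0 :: nat)]}"
  have inj: "inj_on ?c S" for S by (auto simp: inj_on_def)
  obtain A :: "('a, ('a, 'b) test) module" and a where
    A: "left_module R A" and a: "a \<in> left_module_hom R A ?M" "inj_on a (carrier A)"
    "a ` carrier A = J"
    by (rule left_module_transport[OF M J inj])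
  obtain B :: "('a, ('a, 'b) test) module" and b where
    B: "left_module R B" and b: "b \<in> left_module_hom R B ?M" "inj_on b (carrier B)"
    "b ` carrier B = carrier ?M"
    by (rule left_module_transport[OF M R inj])
  have "a ` carrier A \<subseteq> b ` carrier B" using a(3) b(3) submodule_facts(1)[OF J] by simp
  then obtain i where i: "i \<in> left_module_hom R A B" "\<forall>x \<in> carrier A. b (i x) = a x"
    by (rule left_module_hom_factor[OF B A b(1,2) a(1)])
  have i_inj: "inj_on i (carrier A)"
  proof (rule inj_onI)
    fix x y assume xy: "x \<in> carrier A" "y \<in> carrier A" "i x = i y"
    then have "a x = a y" using i(2) by metis
    then show "x = y" using xy a(2) by (simp add: inj_on_eq_iff)
  qed
  have aJ: "a x \<in> J" if "x \<in> carrier A" for x using a(3) that by auto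
  have g: "(\<lambda>x. f (a x)) \<in> left_module_hom R A I"
    using left_module_hom_facts[OF a(1)] aJ f by (auto simp: left_module_hom_def regular_module_def)
  have "\<exists>h \<in> left_module_hom R B I. \<forall>x \<in> carrier A. h (i x) = f (a x)"
    using conjunct2[OF I[unfolded injective_module_def], THEN spec, THEN spec, THEN spec, THEN spec,
        THEN mp, of A B i "\<lambda>x. f (a x)"] A B i(1) i_inj g by simp
  then obtain h where h: "h \<in> left_module_hom R B I" "\<forall>x \<in> carrier A. h (i x) = f (a x)" by blast
  have "\<one>\<^bsub>R\<^esub> \<in> b ` carrier B" by (simp add: b(3)) (simp add: regular_module_def)
  then obtain u where u: "u \<in> carrier B" "b u = \<one>\<^bsub>R\<^esub>" by auto
  interpret B: left_module R B by fact
  have "f r = r \<odot>\<^bsub>I\<^esub> h u" if r: "r \<in> J" for r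
  proof -
    have rR: "r \<in> carrier R" using submodule_facts(1)[OF J] r by (auto simp: regular_module_def)
    obtain x where x: "x \<in> carrier A" "a x = r" using a(3) r by blast
    have "b (r \<odot>\<^bsub>B\<^esub> u) = r" using left_module_hom_facts(3)[OF b(1) rR u(1)] u rR
      by (simp add: regular_module_def)
    also have "r = b (i x)" using i(2) x by simp
    finally have "r \<odot>\<^bsub>B\<^esub> u = i x"
      by (rule inj_onD[OF b(2)]) (use rR u x left_module_hom_facts(1)[OF i(1)] in auto)
    then have "f r = h (r \<odot>\<^bsub>B\<^esub> u)" using h(2) x by simp
    then show ?thesis using left_module_hom_facts(3)[OF h(1) rR u(1)] by simp
  qed
  then show ?thesis using left_module_hom_facts(1)[OF h(1) u(1)] by blast
qed

theorem injective_module_extend: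
  fixes I :: "('a, 'b) module" and A :: "('a, 'c) module" and B :: "('a, 'd) module"
  assumes I: "injective_module R I" and A: "left_module R A" and B: "left_module R B"
    and i: "i \<in> left_module_hom R A B" "inj_on i (carrier A)"
    and g: "g \<in> left_module_hom R A I"
  shows "\<exists>h \<in> left_module_hom R B I. \<forall>x \<in> carrier A. h (i x) = g x"
proof -
  have IM: "left_module R I" using I by (simp add: injective_module_def)
  interpret I: left_module R I by fact
  interpret A: left_module R A by fact
  interpret B: left_module R B by fact
  note ih = left_module_hom_facts[OF i(1)] and gh = left_module_hom_facts[OF g]
  \<comment> \<open>graphs of partial homomorphisms extending \<open>g\<close>\<close>
  define partial where "partial = {G. G \<subseteq> carrier B \<times> carrier I \<and>
      (\<forall>u v u' v'. (u, v) \<in> G \<and> (u', v') \<in> G \<longrightarrow> (u \<oplus>\<^bsub>B\<^esub> u', v \<oplus>\<^bsub>I\<^esub> v') \<in> G) \<and>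
      (\<forall>r u v. r \<in> carrier R \<and> (u, v) \<in> G \<longrightarrow> (r \<odot>\<^bsub>B\<^esub> u, r \<odot>\<^bsub>I\<^esub> v) \<in> G) \<and>
      (\<forall>u v v'. (u, v) \<in> G \<and> (u, v') \<in> G \<longrightarrow> v = v') \<and>
      (\<forall>x \<in> carrier A. (i x, g x) \<in> G)}"
  have p_sub: "u \<in> carrier B \<and> v \<in> carrier I" if "G \<in> partial" "(u, v) \<in> G" for G u v
    using that unfolding partial_def by auto
  have p_add: "(u \<oplus>\<^bsub>B\<^esub> u', v \<oplus>\<^bsub>I\<^esub> v') \<in> G"
    if "G \<in> partial" "(u, v) \<in> G" "(u', v') \<in> G" for G u v u' v'
    using that unfolding partial_def by simp
  have p_sm: "(r \<odot>\<^bsub>B\<^esub> u, r \<odot>\<^bsub>I\<^esub> v) \<in> G" if "G \<in> partial" "r \<in> carrier R" "(u, v) \<in> G" for G r u v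
    using that unfolding partial_def by simp
  have p_sv: "v = v'" if "G \<in> partial" "(u, v) \<in> G" "(u, v') \<in> G" for G u v v'
    using that unfolding partial_def by blast
  have p_ext: "(i x, g x) \<in> G" if "G \<in> partial" "x \<in> carrier A" for G x
    using that unfolding partial_def by simp
  have "\<exists>G\<in>partial. \<forall>X\<in>partial. G \<subseteq> X \<longrightarrow> X = G"
  proof (rule subset_Zorn_nonempty)
    define G0 where "G0 = {(i x, g x) | x. x \<in> carrier A}"
    have "G0 \<in> partial"
      unfolding partial_def
    proof (intro CollectI conjI allI impI ballI)
      show "G0 \<subseteq> carrier B \<times> carrier I" using ih gh by (auto simp: G0_def)
    next
      fix u v u' v' assume "(u, v) \<in> G0 \<and>
        (u', v') \<in> G0"
      then obtain x x' where "x \<in> carrier A" "x' \<in> carrier A" "u = i x" "v = g x" "u' = i x'" "v' = g x'"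
        unfolding G0_def by blast
      then show "(u \<oplus>\<^bsub>B\<^esub> u', v \<oplus>\<^bsub>I\<^esub> v') \<in> G0"
        using ih(2) gh(2) unfolding G0_def by (intro CollectI exI[of _ "x \<oplus>\<^bsub>A\<^esub> x'"]) auto
    next
      fix r u v assume "r \<in> carrier R \<and> (u, v) \<in> G0"
      then obtain x where "x \<in> carrier A" "u = i x" "v = g x" "r \<in> carrier R" unfolding G0_def by blast
      then show "(r \<odot>\<^bsub>B\<^esub> u, r \<odot>\<^bsub>I\<^esub> v) \<in> G0"
        using ih(3) gh(3) unfolding G0_def by (intro CollectI exI[of _ "r \<odot>\<^bsub>A\<^esub> x"]) auto
    next
      fix u v v' assume "(u, v) \<in> G0 \<and>
        (u, v') \<in> G0"
      then obtain x x' where "x \<in> carrier A" "x' \<in> carrier A" "i x = i x'" "v = g x" "v' = g x'"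
        unfolding G0_def by auto
      then show "v = v'" using i(2) by (metis inj_on_eq_iff)
    qed (auto simp: G0_def)
    then show "partial \<noteq> {}" by blast
  next
    fix \<C> assume ne: "\<C> \<noteq> {}" and ch: "subset.chain partial \<C>"
    have CP: "G \<in> partial" if "G \<in> \<C>" for G using ch that by (auto simp: subset.chain_def)
    have lin: "G \<subseteq> G' \<or> G' \<subseteq> G" if "G \<in> \<C>" "G' \<in> \<C>" for G G'
      using ch that by (auto simp: subset.chain_def)
    have two: "\<exists>G\<in>\<C>. p \<in> G \<and> q \<in> G" if "p \<in> \<Union>\<C>" "q \<in> \<Union>\<C>" for p q
    proof -
      obtain G G' where "G \<in> \<C>" "G' \<in> \<C>" "p \<in> G" "q \<in> G'" using \<open>p \<in> \<Union>\<C>\<close> \<open>q \<in> \<Union>\<C>\<close> by blast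
      then show ?thesis using lin[of G G'] by blast
    qed
    show "\<Union>\<C> \<in> partial"
      unfolding partial_def
    proof (intro CollectI conjI allI impI ballI)
      show "\<Union>\<C> \<subseteq> carrier B \<times> carrier I" using p_sub[OF CP] by auto
    next
      fix u v u' v' assume "(u, v) \<in> \<Union>\<C> \<and> (u', v') \<in> \<Union>\<C>"
      then obtain G where *: "G \<in> \<C>" "(u, v) \<in> G" "(u', v') \<in> G" using two by blast
      show "(u \<oplus>\<^bsub>B\<^esub> u', v \<oplus>\<^bsub>I\<^esub> v') \<in> \<Union>\<C>" by (rule UnionI[OF *(1) p_add[OF CP[OF *(1)] *(2,3)]])
    next
      fix r u v assume "r \<in> carrier R \<and> (u, v) \<in> \<Union>\<C>"
      then obtain G where *: "G \<in> \<C>" "r \<in> carrier R" "(u, v) \<in> G" by blast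
      show "(r \<odot>\<^bsub>B\<^esub> u, r \<odot>\<^bsub>I\<^esub> v) \<in> \<Union>\<C>" by (rule UnionI[OF *(1) p_sm[OF CP[OF *(1)] *(2,3)]])
    next
      fix u v v' assume "(u, v) \<in> \<Union>\<C> \<and> (u, v') \<in> \<Union>\<C>"
      then obtain G where *: "G \<in> \<C>" "(u, v) \<in> G" "(u, v') \<in> G" using two by blast
      show "v = v'" by (rule p_sv[OF CP[OF *(1)] *(2,3)])
    next
      fix x assume x: "x \<in> carrier A"
      obtain G where G: "G \<in> \<C>" using ne by blast
      show "(i x, g x) \<in> \<Union>\<C>" by (rule UnionI[OF G p_ext[OF CP[OF G] x]])
    qed
  qed
  then obtain G where G: "G \<in> partial" and Gmax: "\<And>X. X \<in> partial \<Longrightarrow> G \<subseteq> X \<Longrightarrow> X = G" by blast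
  have Gsub: "u \<in> carrier B" "v \<in> carrier I" if "(u, v) \<in> G" for u v
    using p_sub[OF G that] by auto
  note Gadd = p_add[OF G] and Gsm = p_sm[OF G] and Gsv = p_sv[OF G] and GA = p_ext[OF G]
  have G0: "(\<zero>\<^bsub>B\<^esub>, \<zero>\<^bsub>I\<^esub>) \<in> G"
    using GA[of "\<zero>\<^bsub>A\<^esub>"] left_module_hom_zero[OF A B i(1)] left_module_hom_zero[OF A IM g] by simp
  have Gneg: "(\<ominus>\<^bsub>B\<^esub> u, \<ominus>\<^bsub>I\<^esub> v) \<in> G" if "(u, v) \<in> G" for u v
  proof -
    have m: "(\<ominus>\<^bsub>R\<^esub> \<one>\<^bsub>R\<^esub>) \<odot>\<^bsub>B\<^esub> u = \<ominus>\<^bsub>B\<^esub> u" "(\<ominus>\<^bsub>R\<^esub> \<one>\<^bsub>R\<^esub>) \<odot>\<^bsub>I\<^esub> v = \<ominus>\<^bsub>I\<^esub> v"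
      using left_module_minus_one[OF B] left_module_minus_one[OF IM] Gsub[OF that] by auto
    show ?thesis using Gsm[OF _ that, of "\<ominus>\<^bsub>R\<^esub> \<one>\<^bsub>R\<^esub>"] m by simp
  qed
  have dom: "\<exists>v. (b, v) \<in> G" if b: "b \<in> carrier B" for b
  proof -
    let ?M = "regular_module R"
    define J where "J = {r \<in> carrier R. \<exists>v. (r \<odot>\<^bsub>B\<^esub> b, v) \<in> G}"
    define f where "f r = (THE v. (r \<odot>\<^bsub>B\<^esub> b, v) \<in> G)" for r
    have fG: "f r = v" if "(r \<odot>\<^bsub>B\<^esub> b, v) \<in> G" for r v
      unfolding f_def using that Gsv by blast
    have fJ: "(r \<odot>\<^bsub>B\<^esub> b, f r) \<in> G" "r \<in> carrier R" if "r \<in> J" for r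
      using that fG unfolding J_def by auto
    have add: "((r \<oplus>\<^bsub>R\<^esub> s) \<odot>\<^bsub>B\<^esub> b, f r \<oplus>\<^bsub>I\<^esub> f s) \<in> G" if "r \<in> J" "s \<in> J" for r s
      using Gadd[OF fJ(1)[OF that(1)] fJ(1)[OF that(2)]] fJ(2) that b by (simp add: B.smult_l_distr)
    have sm: "((r \<otimes>\<^bsub>R\<^esub> s) \<odot>\<^bsub>B\<^esub> b, r \<odot>\<^bsub>I\<^esub> f s) \<in> G" if "r \<in> carrier R" "s \<in> J" for r s
      using Gsm[OF that(1) fJ(1)[OF that(2)]] fJ(2) that b by (simp add: B.smult_assoc1)
    have zb: "\<zero>\<^bsub>R\<^esub> \<odot>\<^bsub>B\<^esub> b = \<zero>\<^bsub>B\<^esub>" by (rule left_module_smult_l_null[OF B b])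
    have J: "submodule J R ?M"
    proof (rule submodule_of_left_moduleI[OF left_module_regular[OF I.R.ring_axioms]])
      show "J \<subseteq> carrier ?M" by (auto simp: J_def regular_module_def)
      show "\<zero>\<^bsub>?M\<^esub> \<in> J" using G0 zb by (auto simp: J_def regular_module_def)
      show "r \<oplus>\<^bsub>?M\<^esub> s \<in> J" if "r \<in> J" "s \<in> J" for r s
        using add[OF that] fJ(2) that by (auto simp: J_def regular_module_def)
      show "r \<odot>\<^bsub>?M\<^esub> s \<in> J" if "r \<in> carrier R" "s \<in> J" for r s
        using sm[OF that] fJ(2) that by (auto simp: J_def regular_module_def)
    qed
    have "\<exists>x \<in> carrier I. \<forall>r \<in> J. f r = r \<odot>\<^bsub>I\<^esub> x"
      by (rule injective_module_ideal[OF I J]) (use fJ(1) Gsub(2) fG add sm in blast)+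
    then obtain x where x: "x \<in> carrier I" "\<And>r. r \<in> J \<Longrightarrow> f r = r \<odot>\<^bsub>I\<^esub> x" by blast
    define G' where "G' = {(u \<oplus>\<^bsub>B\<^esub> r \<odot>\<^bsub>B\<^esub> b, v \<oplus>\<^bsub>I\<^esub> r \<odot>\<^bsub>I\<^esub> x) | u v r. (u, v) \<in> G \<and> r \<in> carrier R}"
    have G'I: "(u \<oplus>\<^bsub>B\<^esub> r \<odot>\<^bsub>B\<^esub> b, v \<oplus>\<^bsub>I\<^esub> r \<odot>\<^bsub>I\<^esub> x) \<in> G'" if "(u, v) \<in> G" "r \<in> carrier R" for u v r
      using that unfolding G'_def by blast
    have GG': "G \<subseteq> G'"
    proof
      fix p assume "p \<in> G"
      moreover obtain u v where p: "p = (u, v)" by fastforce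
      ultimately show "p \<in> G'"
        using G'I[of u v "\<zero>\<^bsub>R\<^esub>"] Gsub[of u v] zb left_module_smult_l_null[OF IM x(1)] by simp
    qed
    have "G' \<in> partial"
      unfolding partial_def
    proof (intro CollectI conjI allI impI ballI)
      show "G' \<subseteq> carrier B \<times> carrier I" using Gsub b x(1) by (auto simp: G'_def)
    next
      fix u v u' v' assume "(u, v) \<in> G' \<and> (u', v') \<in> G'"
      then obtain u1 v1 r1 u2 v2 r2 where *: "(u1, v1) \<in> G" "r1 \<in> carrier R" "(u2, v2) \<in> G"
        "r2 \<in> carrier R" and eq: "u = u1 \<oplus>\<^bsub>B\<^esub> r1 \<odot>\<^bsub>B\<^esub> b" "v = v1 \<oplus>\<^bsub>I\<^esub> r1 \<odot>\<^bsub>I\<^esub> x"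
        "u' = u2 \<oplus>\<^bsub>B\<^esub> r2 \<odot>\<^bsub>B\<^esub> b" "v' = v2 \<oplus>\<^bsub>I\<^esub> r2 \<odot>\<^bsub>I\<^esub> x" unfolding G'_def by blast
      have "u \<oplus>\<^bsub>B\<^esub> u' = (u1 \<oplus>\<^bsub>B\<^esub> u2) \<oplus>\<^bsub>B\<^esub> (r1 \<oplus>\<^bsub>R\<^esub> r2) \<odot>\<^bsub>B\<^esub> b"
        using * Gsub b unfolding eq by (simp add: B.smult_l_distr B.M.a_ac)
      moreover have "v \<oplus>\<^bsub>I\<^esub> v' = (v1 \<oplus>\<^bsub>I\<^esub> v2) \<oplus>\<^bsub>I\<^esub> (r1 \<oplus>\<^bsub>R\<^esub> r2) \<odot>\<^bsub>I\<^esub> x"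
        using * Gsub x unfolding eq by (simp add: I.smult_l_distr I.M.a_ac)
      ultimately show "(u \<oplus>\<^bsub>B\<^esub> u', v \<oplus>\<^bsub>I\<^esub> v') \<in> G'"
        using G'I[OF Gadd[OF *(1) *(3)]] * by simp
    next
      fix r u v assume "r \<in> carrier R \<and> (u, v) \<in> G'"
      then obtain u1 v1 r1 where *: "r \<in> carrier R" "(u1, v1) \<in> G" "r1 \<in> carrier R"
        and eq: "u = u1 \<oplus>\<^bsub>B\<^esub> r1 \<odot>\<^bsub>B\<^esub> b" "v = v1 \<oplus>\<^bsub>I\<^esub> r1 \<odot>\<^bsub>I\<^esub> x" unfolding G'_def by blast
      have "r \<odot>\<^bsub>B\<^esub> u = r \<odot>\<^bsub>B\<^esub> u1 \<oplus>\<^bsub>B\<^esub> (r \<otimes>\<^bsub>R\<^esub> r1) \<odot>\<^bsub>B\<^esub> b"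
        using * Gsub b unfolding eq by (simp add: B.smult_r_distr B.smult_assoc1)
      moreover have "r \<odot>\<^bsub>I\<^esub> v = r \<odot>\<^bsub>I\<^esub> v1 \<oplus>\<^bsub>I\<^esub> (r \<otimes>\<^bsub>R\<^esub> r1) \<odot>\<^bsub>I\<^esub> x"
        using * Gsub x unfolding eq by (simp add: I.smult_r_distr I.smult_assoc1)
      ultimately show "(r \<odot>\<^bsub>B\<^esub> u, r \<odot>\<^bsub>I\<^esub> v) \<in> G'"
        using G'I[OF Gsm[OF *(1) *(2)]] * by simp
    next
      fix u v v' assume "(u, v) \<in> G' \<and> (u, v') \<in> G'"
      then obtain u1 v1 r1 u2 v2 r2 where *: "(u1, v1) \<in> G" "r1 \<in> carrier R" "(u2, v2) \<in> G"
        "r2 \<in> carrier R" and eq: "u = u1 \<oplus>\<^bsub>B\<^esub> r1 \<odot>\<^bsub>B\<^esub> b" "v = v1 \<oplus>\<^bsub>I\<^esub> r1 \<odot>\<^bsub>I\<^esub> x"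
        "u = u2 \<oplus>\<^bsub>B\<^esub> r2 \<odot>\<^bsub>B\<^esub> b" "v' = v2 \<oplus>\<^bsub>I\<^esub> r2 \<odot>\<^bsub>I\<^esub> x" unfolding G'_def by blast
      define s where "s = r1 \<oplus>\<^bsub>R\<^esub> \<ominus>\<^bsub>R\<^esub> r2"
      have s: "s \<in> carrier R" and r1: "r1 = s \<oplus>\<^bsub>R\<^esub> r2"
        using * by (auto simp: s_def I.R.a_assoc I.R.l_neg)
      have uc: "u1 \<in> carrier B" "u2 \<in> carrier B" "v1 \<in> carrier I" "v2 \<in> carrier I"
        using * Gsub by auto
      have sb: "s \<odot>\<^bsub>B\<^esub> b \<in> carrier B" "r2 \<odot>\<^bsub>B\<^esub> b \<in> carrier B" using s * b by auto
      have "(u1 \<oplus>\<^bsub>B\<^esub> s \<odot>\<^bsub>B\<^esub> b) \<oplus>\<^bsub>B\<^esub> r2 \<odot>\<^bsub>B\<^esub> b = u2 \<oplus>\<^bsub>B\<^esub> r2 \<odot>\<^bsub>B\<^esub> b"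
        using eq(1,3) s * b uc unfolding r1 by (simp add: B.smult_l_distr B.M.a_assoc)
      then have e1: "u1 \<oplus>\<^bsub>B\<^esub> s \<odot>\<^bsub>B\<^esub> b = u2" using uc sb by (simp add: B.M.add.right_cancel)
      have "s \<odot>\<^bsub>B\<^esub> b = \<ominus>\<^bsub>B\<^esub> u1 \<oplus>\<^bsub>B\<^esub> u2"
        unfolding e1[symmetric] using uc sb by (simp add: B.M.a_assoc[symmetric] B.M.l_neg)
      then have sG: "(s \<odot>\<^bsub>B\<^esub> b, \<ominus>\<^bsub>I\<^esub> v1 \<oplus>\<^bsub>I\<^esub> v2) \<in> G" using Gadd[OF Gneg[OF *(1)] *(3)] by simp
      then have sx: "s \<odot>\<^bsub>I\<^esub> x = \<ominus>\<^bsub>I\<^esub> v1 \<oplus>\<^bsub>I\<^esub> v2" using fG[OF sG] x(2)[of s] s sG unfolding J_def by force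
      have "v = v1 \<oplus>\<^bsub>I\<^esub> (s \<odot>\<^bsub>I\<^esub> x \<oplus>\<^bsub>I\<^esub> r2 \<odot>\<^bsub>I\<^esub> x)"
        using eq(2) s * x unfolding r1 by (simp add: I.smult_l_distr)
      also have "\<dots> = (v1 \<oplus>\<^bsub>I\<^esub> \<ominus>\<^bsub>I\<^esub> v1) \<oplus>\<^bsub>I\<^esub> v2 \<oplus>\<^bsub>I\<^esub> r2 \<odot>\<^bsub>I\<^esub> x"
        unfolding sx using uc * x by (simp add: I.M.a_assoc)
      also have "\<dots> = v'" unfolding eq using uc * x by (simp add: I.M.r_neg)
      finally show "v = v'" .
    next
      fix y assume "y \<in> carrier A"
      then show "(i y, g y) \<in> G'" using GA GG' by blast
    qed
    then have "G' = G" by (rule Gmax) (rule GG')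
    moreover have "(\<zero>\<^bsub>B\<^esub> \<oplus>\<^bsub>B\<^esub> \<one>\<^bsub>R\<^esub> \<odot>\<^bsub>B\<^esub> b, \<zero>\<^bsub>I\<^esub> \<oplus>\<^bsub>I\<^esub> \<one>\<^bsub>R\<^esub> \<odot>\<^bsub>I\<^esub> x) \<in> G'"
      by (rule G'I[OF G0]) simp
    ultimately show ?thesis using b by auto
  qed
  define h where "h u = (THE v. (u, v) \<in> G)" for u
  have hG: "h u = v" if "(u, v) \<in> G" for u v unfolding h_def using that Gsv by blast
  have hin: "(u, h u) \<in> G" if "u \<in> carrier B" for u using dom[OF that] hG by blast
  have "h \<in> left_module_hom R B I"
    unfolding left_module_hom_def
    using hin Gsub(2) hG[OF Gadd[OF hin hin]] hG[OF Gsm[OF _ hin]] by auto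
  then show ?thesis using hG[OF GA] by blast
qed


lemma frag_fst_simps [simp]:
  "frag_fst f 0 = 0" "frag_fst f (frag_of (a, x)) = frag_of (f a, x)"
  "frag_fst f (u + v) = frag_fst f u + frag_fst f v"
  "frag_fst f (u - v) = frag_fst f u - frag_fst f v" "frag_fst f (- u) = - frag_fst f u"
  by (simp_all add: frag_fst_def frag_extend_add frag_extend_diff frag_extend_minus)

lemma frag_fst_comp_cong:
  assumes "Poly_Mapping.keys u \<subseteq> S \<times> T" "\<And>a. a \<in> S \<Longrightarrow> g (f a) = h a"
  shows "frag_fst g (frag_fst f u) = frag_fst h u"
  using assms(1) by (induction u rule: frag_induction) (auto simp: assms(2))

lemma frag_fst_id:
  assumes "Poly_Mapping.keys u \<subseteq> S \<times> T" "\<And>a. a \<in> S \<Longrightarrow> g (f a) = a"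
  shows "frag_fst g (frag_fst f u) = u"
  using assms(1) by (induction u rule: frag_induction) (auto simp: assms(2))

lemma keys_frag_fst:
  assumes "Poly_Mapping.keys u \<subseteq> S \<times> T" "f ` S \<subseteq> S'"
  shows "Poly_Mapping.keys (frag_fst f u) \<subseteq> S' \<times> T"
  using assms(1)
proof (induction u rule: frag_induction)
  case (one p)
  then show ?case using assms(2) by (auto simp: keys_frag_of split: prod.splits)
next
  case (diff u v)
  then show ?case using keys_diff[of "frag_fst f u" "frag_fst f v"] by auto
qed simp

lemma left_module_opposite_ring_facts:
  assumes "right_module R A"
  shows "\<And>a a'. a \<in> carrier A \<Longrightarrow> a' \<in> carrier A \<Longrightarrow> a \<oplus>\<^bsub>A\<^esub> a' \<in> carrier A"
    "\<And>r a. r \<in> carrier R \<Longrightarrow> a \<in> carrier A \<Longrightarrow> r \<odot>\<^bsub>A\<^esub> a \<in> carrier A"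
proof -
  interpret left_module "opposite_ring R" A by fact
  show "\<And>a a'. a \<in> carrier A \<Longrightarrow> a' \<in> carrier A \<Longrightarrow> a \<oplus>\<^bsub>A\<^esub> a' \<in> carrier A" by simp
  show "\<And>r a. r \<in> carrier R \<Longrightarrow> a \<in> carrier A \<Longrightarrow> r \<odot>\<^bsub>A\<^esub> a \<in> carrier A"
    using smult_closed by (simp add: opposite_ring_def)
qed

lemma tensor_relationsE:
  assumes "u \<in> tensor_relations R A F"
  obtains
    (1) a a' x where "u = frag_of (a \<oplus>\<^bsub>A\<^esub> a', x) - frag_of (a, x) - frag_of (a', x)"
      "a \<in> carrier A" "a' \<in> carrier A" "x \<in> carrier F"
  | (2) a x x' where "u = frag_of (a, x \<oplus>\<^bsub>F\<^esub> x') - frag_of (a, x) - frag_of (a, x')"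
      "a \<in> carrier A" "x \<in> carrier F" "x' \<in> carrier F"
  | (3) r a x where "u = frag_of (r \<odot>\<^bsub>A\<^esub> a, x) - frag_of (a, r \<odot>\<^bsub>F\<^esub> x)"
      "r \<in> carrier R" "a \<in> carrier A" "x \<in> carrier F"
  using assms unfolding tensor_relations_def by blast

lemma tensor_relations_keys:
  assumes A: "right_module R A" and F: "left_module R F" and u: "u \<in> tensor_relations R A F"
  shows "Poly_Mapping.keys u \<subseteq> carrier A \<times> carrier F"
proof -
  interpret F: left_module R F by fact
  note Af = left_module_opposite_ring_facts[OF A]
  have d: "Poly_Mapping.keys (v - w) \<subseteq> carrier A \<times> carrier F"
    if "Poly_Mapping.keys v \<subseteq> carrier A \<times> carrier F" "Poly_Mapping.keys w \<subseteq> carrier A \<times> carrier F"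
    for v w :: "'c \<times> 'd \<Rightarrow>\<^sub>0 int"
    using keys_diff[of v w] that by blast
  from u show ?thesis
  proof (cases rule: tensor_relationsE)
    case 1
    show ?thesis unfolding 1(1) using 1 Af by (intro d) (auto simp: keys_frag_of)
  next
    case 2
    show ?thesis unfolding 2(1) using 2 by (intro d) (auto simp: keys_frag_of)
  next
    case 3
    show ?thesis unfolding 3(1) using 3 Af by (intro d) (auto simp: keys_frag_of)
  qed
qed

lemma tensor_null_subgroup:
  assumes "right_module R A" "left_module R F"
  shows "subgroup (tensor_null R A F) (free_Abelian_group (carrier A \<times> carrier F))"
  unfolding tensor_null_def
  by (rule group.generate_is_subgroup[OF group_free_Abelian_group])
    (use tensor_relations_keys[OF assms] in auto)

lemma tensor_null_facts:
  assumes "right_module R A" "left_module R F"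
  shows "\<And>u. u \<in> tensor_null R A F \<Longrightarrow> Poly_Mapping.keys u \<subseteq> carrier A \<times> carrier F"
    "0 \<in> tensor_null R A F"
    "\<And>u v. u \<in> tensor_null R A F \<Longrightarrow> v \<in> tensor_null R A F \<Longrightarrow> u + v \<in> tensor_null R A F"
    "\<And>u. u \<in> tensor_null R A F \<Longrightarrow> - u \<in> tensor_null R A F"
proof -
  note s = tensor_null_subgroup[OF assms]
  show k: "Poly_Mapping.keys u \<subseteq> carrier A \<times> carrier F" if "u \<in> tensor_null R A F" for u
    using subsetD[OF subgroup.subset[OF s] that] by simp
  show "0 \<in> tensor_null R A F" using subgroup.one_closed[OF s] by simp
  show "\<And>u v. u \<in> tensor_null R A F \<Longrightarrow> v \<in> tensor_null R A F \<Longrightarrow> u + v \<in> tensor_null R A F"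
    using subgroup.m_closed[OF s] by simp
  show "\<And>u. u \<in> tensor_null R A F \<Longrightarrow> - u \<in> tensor_null R A F"
    using subgroup.m_inv_closed[OF s] k by simp
qed

lemma tensor_relations_map:
  assumes f: "f \<in> left_module_hom (opposite_ring R) A B" and A: "right_module R A"
    and u: "u \<in> tensor_relations R A F"
  shows "frag_fst f u \<in> tensor_relations R B F"
proof -
  note ff = left_module_hom_facts[OF f, unfolded opposite_ring_def, simplified]
  from u show ?thesis
  proof (cases rule: tensor_relationsE)
    case (1 a a' x)
    then have "frag_fst f u = frag_of (f a \<oplus>\<^bsub>B\<^esub> f a', x) - frag_of (f a, x) - frag_of (f a', x)"
      using ff by simp
    then show ?thesis using ff(1) 1 unfolding tensor_relations_def by blast
  next
    case (2 a x x')
    then have "frag_fst f u = frag_of (f a, x \<oplus>\<^bsub>F\<^esub> x') - frag_of (f a, x) - frag_of (f a, x')"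
      by simp
    then show ?thesis using ff(1) 2 unfolding tensor_relations_def by blast
  next
    case (3 r a x)
    then have "frag_fst f u = frag_of (r \<odot>\<^bsub>B\<^esub> f a, x) - frag_of (f a, r \<odot>\<^bsub>F\<^esub> x)"
      using ff by simp
    then show ?thesis using ff(1) 3 unfolding tensor_relations_def by blast
  qed
qed

lemma tensor_null_map:
  assumes f: "f \<in> left_module_hom (opposite_ring R) A B"
    and A: "right_module R A" and B: "right_module R B" and F: "left_module R F"
    and u: "u \<in> tensor_null R A F"
  shows "frag_fst f u \<in> tensor_null R B F"
  using u unfolding tensor_null_def[of R A F]
proof (induction u rule: generate.induct)
  case one
  then show ?case by (simp add: tensor_null_facts(2)[OF B F])
next
  case (incl u)
  have "frag_fst f u \<in> tensor_relations R B F" by (rule tensor_relations_map[OF f A incl])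
  then show ?case unfolding tensor_null_def by (rule generate.incl)
next
  case (inv u)
  have "frag_fst f u \<in> tensor_relations R B F" by (rule tensor_relations_map[OF f A inv])
  then have "frag_fst f u \<in> tensor_null R B F" unfolding tensor_null_def by (rule generate.incl)
  then show ?case using tensor_relations_keys[OF A F inv] by (simp add: tensor_null_facts(4)[OF B F])
next
  case (eng u v)
  then show ?case by (simp add: tensor_null_facts(3)[OF B F])
qed

lemma inj_on_tensor_map_iff:
  assumes f: "f \<in> left_module_hom (opposite_ring R) A B"
    and A: "right_module R A" and B: "right_module R B" and F: "left_module R F"
  shows "inj_on (tensor_map R B F f) (carrier (tensor_product R A F)) \<longleftrightarrow>
    (\<forall>u. Poly_Mapping.keys u \<subseteq> carrier A \<times> carrier F \<and> frag_fst f u \<in> tensor_null R B F \<longrightarrow>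
      u \<in> tensor_null R A F)"
proof -
  let ?NA = "tensor_null R A F" and ?NB = "tensor_null R B F"
  let ?GA = "free_Abelian_group (carrier A \<times> carrier F)"
  let ?GB = "free_Abelian_group (carrier B \<times> carrier F)"
  note NA = tensor_null_facts[OF A F] and NB = tensor_null_facts[OF B F]
  have cos: "N #>\<^bsub>free_Abelian_group S\<^esub> u = (\<lambda>n. n + u) ` N" for N S and u :: "'x \<Rightarrow>\<^sub>0 int"
    by (auto simp: r_coset_def)
  have cos_eq: "(\<lambda>n. n + u) ` N = (\<lambda>n. n + v) ` N \<longleftrightarrow> u - v \<in> N"
    if z: "0 \<in> N" and a: "\<And>u v. u \<in> N \<Longrightarrow> v \<in> N \<Longrightarrow> u + v \<in> N" and m: "\<And>u. u \<in> N \<Longrightarrow> - u \<in> N"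
    for N and u v :: "'x \<Rightarrow>\<^sub>0 int"
  proof
    assume "(\<lambda>n. n + u) ` N = (\<lambda>n. n + v) ` N"
    then have "0 + u \<in> (\<lambda>n. n + v) ` N" using z by (metis imageI)
    then show "u - v \<in> N" by auto
  next
    assume uv: "u - v \<in> N"
    have "n + u \<in> (\<lambda>n. n + v) ` N" if "n \<in> N" for n
      using a[OF that uv] by (intro image_eqI[of _ _ "n + (u - v)"]) auto
    moreover have "n + v \<in> (\<lambda>n. n + u) ` N" if "n \<in> N" for n
      using a[OF that m[OF uv]] by (intro image_eqI[of _ _ "n + - (u - v)"]) auto
    ultimately show "(\<lambda>n. n + u) ` N = (\<lambda>n. n + v) ` N" by blast
  qed
  have eqA: "(\<lambda>n. n + u) ` ?NA = (\<lambda>n. n + v) ` ?NA \<longleftrightarrow> u - v \<in> ?NA" for u v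
    by (rule cos_eq) (rule NA; assumption)+
  have eqB: "(\<lambda>n. n + u) ` ?NB = (\<lambda>n. n + v) ` ?NB \<longleftrightarrow> u - v \<in> ?NB" for u v
    by (rule cos_eq) (rule NB; assumption)+
  have carr: "carrier (tensor_product R A F) =
      (\<lambda>u. (\<lambda>n. n + u) ` ?NA) ` {u. Poly_Mapping.keys u \<subseteq> carrier A \<times> carrier F}"
    unfolding tensor_product_def FactGroup_def RCOSETS_def
    by (simp add: cos UNION_singleton_eq_range)
      (simp add: free_Abelian_group_def)
  have tm: "tensor_map R B F f ((\<lambda>n. n + u) ` ?NA) = (\<lambda>n. n + frag_fst f u) ` ?NB" for u
  proof -
    have "(\<lambda>n. n + frag_fst f w) ` ?NB = (\<lambda>n. n + frag_fst f u) ` ?NB"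
      if "w \<in> (\<lambda>n. n + u) ` ?NA" for w
    proof -
      from that obtain n where n: "w = n + u" "n \<in> ?NA" by (rule imageE)
      have "frag_fst f w - frag_fst f u \<in> ?NB" using tensor_null_map[OF f A B F n(2)] n(1) by simp
      then show ?thesis by (rule iffD2[OF eqB])
    qed
    moreover have "(\<lambda>n. n + u) ` ?NA \<noteq> {}" using NA(2) by (metis empty_iff image_is_empty)
    ultimately show ?thesis unfolding tensor_map_def cos by (rule the_elem_image_unique[rotated])
  qed
  show ?thesis
  proof
    assume inj: "inj_on (tensor_map R B F f) (carrier (tensor_product R A F))"
    show "\<forall>u. Poly_Mapping.keys u \<subseteq> carrier A \<times> carrier F \<and> frag_fst f u \<in> ?NB \<longrightarrow> u \<in> ?NA"
    proof (intro allI impI)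
      fix u assume u: "Poly_Mapping.keys u \<subseteq> carrier A \<times> carrier F \<and> frag_fst f u \<in> ?NB"
      have "(\<lambda>n. n + u) ` ?NA = (\<lambda>n. n + 0) ` ?NA"
      proof (rule inj_onD[OF inj])
        show "tensor_map R B F f ((\<lambda>n. n + u) ` ?NA) = tensor_map R B F f ((\<lambda>n. n + 0) ` ?NA)"
          unfolding tm eqB using u by simp
        show "(\<lambda>n. n + u) ` ?NA \<in> carrier (tensor_product R A F)" unfolding carr using u by (intro imageI) simp
        show "(\<lambda>n. n + 0) ` ?NA \<in> carrier (tensor_product R A F)" unfolding carr by (intro imageI) simp
      qed
      then show "u \<in> ?NA" unfolding eqA by simp
    qed
  next
    assume R: "\<forall>u. Poly_Mapping.keys u \<subseteq> carrier A \<times> carrier F \<and> frag_fst f u \<in> ?NB \<longrightarrow> u \<in> ?NA"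
    show "inj_on (tensor_map R B F f) (carrier (tensor_product R A F))"
    proof (rule inj_onI)
      fix X Y assume "X \<in> carrier (tensor_product R A F)" "Y \<in> carrier (tensor_product R A F)"
        and eq: "tensor_map R B F f X = tensor_map R B F f Y"
      then obtain u v where uv: "X = (\<lambda>n. n + u) ` ?NA" "Y = (\<lambda>n. n + v) ` ?NA"
        "Poly_Mapping.keys u \<subseteq> carrier A \<times> carrier F" "Poly_Mapping.keys v \<subseteq> carrier A \<times> carrier F"
        unfolding carr by (auto elim!: imageE simp only: mem_Collect_eq)
      have "frag_fst f (u - v) \<in> ?NB" using eq unfolding uv tm eqB by simp
      moreover have "Poly_Mapping.keys (u - v) \<subseteq> carrier A \<times> carrier F"
        using keys_diff[of u v] uv by blast
      ultimately have "u - v \<in> ?NA" using R by blast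
      then show "X = Y" unfolding uv eqA .
    qed
  qed
qed

text \<open>A relation in \<open>B \<otimes> F\<close> already holds over each submodule of \<open>B\<close> that contains a suitable
  finite set.\<close>

lemma tensor_null_finite:
  fixes N :: "('a, 'e) module"
  assumes B: "right_module R B" and F: "left_module R F" and u: "u \<in> tensor_null R B F"
  shows "\<exists>Y. finite Y \<and> Y \<subseteq> carrier B \<and>
    (\<forall>(N :: ('a, 'e) module) e. right_module R N \<and> e \<in> left_module_hom (opposite_ring R) N B \<and>
      Y \<subseteq> e ` carrier N \<longrightarrow> (\<exists>w \<in> tensor_null R N F. frag_fst e w = u))"
proof -
  let ?P = "\<lambda>Y u. finite Y \<and> Y \<subseteq> carrier B \<and>
    (\<forall>(N :: ('a, 'e) module) e. right_module R N \<and> e \<in> left_module_hom (opposite_ring R) N B \<and>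
      Y \<subseteq> e ` carrier N \<longrightarrow> (\<exists>w \<in> tensor_null R N F. frag_fst e w = u))"
  have rel: "\<exists>Y. ?P Y u" if "u \<in> tensor_relations R B F" for u
  proof -
    from that show ?thesis
    proof (cases rule: tensor_relationsE)
      case (1 a a' x)
      have "?P {a, a'} u"
      proof (intro conjI allI impI)
        fix N :: "('a, 'e) module" and e
        assume *: "right_module R N \<and> e \<in> left_module_hom (opposite_ring R) N B \<and> {a, a'} \<subseteq> e ` carrier N"
        then obtain c c' where c: "c \<in> carrier N" "c' \<in> carrier N" "a = e c" "a' = e c'" by auto
        let ?w = "frag_of (c \<oplus>\<^bsub>N\<^esub> c', x) - frag_of (c, x) - frag_of (c', x)"
        have "?w \<in> tensor_relations R N F" using c 1 unfolding tensor_relations_def by blast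
        moreover have "frag_fst e ?w = u" using left_module_hom_facts(2)[OF conjunct1[OF conjunct2[OF *]] c(1,2)] c 1 by simp
        ultimately show "\<exists>w \<in> tensor_null R N F. frag_fst e w = u"
          unfolding tensor_null_def by (intro bexI[of _ ?w] generate.incl)
      qed (use 1 in auto)
      then show ?thesis by blast
    next
      case (2 a x x')
      have "?P {a} u"
      proof (intro conjI allI impI)
        fix N :: "('a, 'e) module" and e
        assume *: "right_module R N \<and> e \<in> left_module_hom (opposite_ring R) N B \<and> {a} \<subseteq> e ` carrier N"
        then obtain c where c: "c \<in> carrier N" "a = e c" by auto
        let ?w = "frag_of (c, x \<oplus>\<^bsub>F\<^esub> x') - frag_of (c, x) - frag_of (c, x')"
        have "?w \<in> tensor_relations R N F" using c 2 unfolding tensor_relations_def by blast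
        moreover have "frag_fst e ?w = u" using c 2 by simp
        ultimately show "\<exists>w \<in> tensor_null R N F. frag_fst e w = u"
          unfolding tensor_null_def by (intro bexI[of _ ?w] generate.incl)
      qed (use 2 in auto)
      then show ?thesis by blast
    next
      case (3 r a x)
      have "?P {a} u"
      proof (intro conjI allI impI)
        fix N :: "('a, 'e) module" and e
        assume *: "right_module R N \<and> e \<in> left_module_hom (opposite_ring R) N B \<and> {a} \<subseteq> e ` carrier N"
        then obtain c where c: "c \<in> carrier N" "a = e c" by auto
        let ?w = "frag_of (r \<odot>\<^bsub>N\<^esub> c, x) - frag_of (c, r \<odot>\<^bsub>F\<^esub> x)"
        have "?w \<in> tensor_relations R N F" using c 3 unfolding tensor_relations_def by blast
        moreover have "r \<in> carrier (opposite_ring R)" using 3 by (simp add: opposite_ring_def)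
        then have "frag_fst e ?w = u" using left_module_hom_facts(3)[OF conjunct1[OF conjunct2[OF *]] _ c(1), of r] c 3 by simp
        ultimately show "\<exists>w \<in> tensor_null R N F. frag_fst e w = u"
          unfolding tensor_null_def by (intro bexI[of _ ?w] generate.incl)
      qed (use 3 in auto)
      then show ?thesis by blast
    qed
  qed
  have "\<exists>Y. ?P Y u"
    using u unfolding tensor_null_def[of R B F]
  proof (induction u rule: generate.induct)
    case one
    have "?P {} 0"
    proof (intro conjI allI impI)
      fix N :: "('a, 'e) module" and e
      assume "right_module R N \<and> e \<in> left_module_hom (opposite_ring R) N B \<and> {} \<subseteq> e ` carrier N"
      then show "\<exists>w \<in> tensor_null R N F. frag_fst e w = 0"
        using tensor_null_facts(2)[OF _ F, of N] by (intro bexI[of _ 0]) auto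
    qed auto
    then show ?case by (metis one_free_Abelian_group)
  next
    case (incl u)
    then show ?case by (rule rel)
  next
    case (inv u)
    obtain Y where Y: "?P Y u" using rel[OF inv] by (rule exE)
    have "?P Y (- u)"
    proof (intro conjI allI impI)
      fix N :: "('a, 'e) module" and e
      assume *: "right_module R N \<and> e \<in> left_module_hom (opposite_ring R) N B \<and> Y \<subseteq> e ` carrier N"
      then obtain w where w: "w \<in> tensor_null R N F" "frag_fst e w = u" using Y by blast
      then show "\<exists>w \<in> tensor_null R N F. frag_fst e w = - u"
        using tensor_null_facts(4)[OF _ F, of N w] * by (intro bexI[of _ "- w"]) auto
    qed (use Y in auto)
    then show ?case using tensor_relations_keys[OF B F inv] by (intro exI[of _ Y]) simp
  next
    case (eng u v)
    obtain Y where Y: "?P Y u" using eng(3) by (rule exE)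
    obtain Z where Z: "?P Z v" using eng(4) by (rule exE)
    have "?P (Y \<union> Z) (u + v)"
    proof (intro conjI allI impI)
      fix N :: "('a, 'e) module" and e
      assume *: "right_module R N \<and> e \<in> left_module_hom (opposite_ring R) N B \<and> Y \<union> Z \<subseteq> e ` carrier N"
      obtain w where w: "w \<in> tensor_null R N F" "frag_fst e w = u" using Y * by blast
      obtain z where z: "z \<in> tensor_null R N F" "frag_fst e z = v" using Z * by blast
      show "\<exists>w \<in> tensor_null R N F. frag_fst e w = u + v"
        using tensor_null_facts(3)[OF _ F, of N w z] * w z by (intro bexI[of _ "w + z"]) auto
    qed (use Y Z in auto)
    then show ?case by (intro exI[of _ "Y \<union> Z"]) simp
  qed
  then show ?thesis .
qed

theorem flat_module_inj:
  fixes F :: "('a, 'b) module" and A :: "('a, 'c) module" and B :: "('a, 'd) module"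
  assumes F: "flat_module R F" and A: "right_module R A" and B: "right_module R B"
    and i: "i \<in> left_module_hom (opposite_ring R) A B" "inj_on i (carrier A)"
  shows "inj_on (tensor_map R B F i) (carrier (tensor_product R A F))"
proof -
  let ?Rop = "opposite_ring R"
  have FM: "left_module R F" using F by (simp add: flat_module_def)
  interpret A: left_module ?Rop A by fact
  interpret B: left_module ?Rop B by fact
  have "u \<in> tensor_null R A F"
    if u: "Poly_Mapping.keys u \<subseteq> carrier A \<times> carrier F" "frag_fst i u \<in> tensor_null R B F" for u
  proof -
    obtain Y where Y0: "finite Y \<and> Y \<subseteq> carrier B \<and>
      (\<forall>(N :: ('a, ('a, 'b) test) module) e. right_module R N \<and> e \<in> left_module_hom ?Rop N B \<and>
        Y \<subseteq> e ` carrier N \<longrightarrow> (\<exists>w \<in> tensor_null R N F. frag_fst e w = frag_fst i u))"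
      using tensor_null_finite[where 'e = "('a, 'b) test", OF B FM u(2)] by (rule exE)
    note Y = conjunct1[OF Y0] conjunct1[OF conjunct2[OF Y0]]
      and Yw = conjunct2[OF conjunct2[OF Y0], THEN spec, THEN spec, THEN mp]
    have "finite (Y \<union> i ` fst ` Poly_Mapping.keys u)" using Y by simp
    from finite_list[OF this] obtain ys where ys: "set ys = Y \<union> i ` fst ` Poly_Mapping.keys u"
      by (rule exE)
    define y :: "'b \<times> nat \<Rightarrow> 'd" where
      "y = (\<lambda>(_, n). if n < length ys then ys ! n else \<zero>\<^bsub>B\<^esub>)"
    have iB: "i ` carrier A \<subseteq> carrier B" using left_module_hom_facts(1)[OF i(1)] by auto
    have "fst ` Poly_Mapping.keys u \<subseteq> carrier A" using u(1) by force
    then have "set ys \<subseteq> carrier B" using Y(2) iB unfolding ys by blast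
    then have yB: "range y \<subseteq> carrier B" using nth_mem by (fastforce simp: y_def)
    obtain N :: "('a, ('a, 'b) test) module" and e where N: "right_module R N"
      and e: "e \<in> left_module_hom ?Rop N B" "inj_on e (carrier N)"
      and ye: "range y \<subseteq> e ` carrier N" and eN: "submodule (e ` carrier N) ?Rop B"
      by (rule left_module_small_copy[OF B yB])
    have yse: "set ys \<subseteq> e ` carrier N"
    proof
      fix b assume "b \<in> set ys"
      then obtain n where "n < length ys" "b = ys ! n" by (metis in_set_conv_nth)
      then have "b = y (undefined, n)" by (simp add: y_def)
      then show "b \<in> e ` carrier N" using ye by auto
    qed
    define H where "H = {a \<in> carrier A. i a \<in> e ` carrier N}"
    note ef = submodule_facts[OF eN]
    have H: "submodule H ?Rop A"
    proof (rule submodule_of_left_moduleI[OF A])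
      show "H \<subseteq> carrier A" by (auto simp: H_def)
      show "\<zero>\<^bsub>A\<^esub> \<in> H" using ef(2) left_module_hom_zero[OF A B i(1)] by (simp add: H_def)
      show "x \<oplus>\<^bsub>A\<^esub> z \<in> H" if "x \<in> H" "z \<in> H" for x z
        using that ef(3) left_module_hom_facts(2)[OF i(1)] by (simp add: H_def)
      show "r \<odot>\<^bsub>A\<^esub> x \<in> H" if "r \<in> carrier ?Rop" "x \<in> H" for r x
        using that ef(5) left_module_hom_facts(3)[OF i(1)] by (simp add: H_def)
    qed
    have c: "inj_on (\<lambda>a. inv_into (carrier N) e (i a)) H"
    proof (rule inj_onI)
      fix a a' assume aa: "a \<in> H" "a' \<in> H" "inv_into (carrier N) e (i a) = inv_into (carrier N) e (i a')"
      then have "i a = i a'" by (auto simp: H_def dest: inv_into_injective)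
      then show "a = a'" using aa i(2) by (auto simp: H_def inj_on_eq_iff)
    qed
    obtain A0 :: "('a, ('a, 'b) test) module" and k where A0: "right_module R A0"
      and k: "k \<in> left_module_hom ?Rop A0 A" "inj_on k (carrier A0)" "k ` carrier A0 = H"
      by (rule left_module_transport[OF A H c])
    have ik: "(\<lambda>a. i (k a)) \<in> left_module_hom ?Rop A0 B" by (rule left_module_hom_comp[OF k(1) i(1)])
    have "(\<lambda>a. i (k a)) ` carrier A0 \<subseteq> e ` carrier N" using k(3) unfolding H_def by blast
    then obtain j where j: "j \<in> left_module_hom ?Rop A0 N" "\<forall>a \<in> carrier A0. e (j a) = i (k a)"
      by (rule left_module_hom_factor[OF N A0 e ik])
    have jinj: "inj_on j (carrier A0)"
    proof (rule inj_onI)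
      fix a a' assume aa: "a \<in> carrier A0" "a' \<in> carrier A0" "j a = j a'"
      then have "i (k a) = i (k a')" using j(2) by metis
      then have "k a = k a'" using i(2) aa left_module_hom_facts(1)[OF k(1)] by (simp add: inj_on_eq_iff)
      then show "a = a'" using k(2) aa by (simp add: inj_on_eq_iff)
    qed
    define ua where "ua = frag_fst (inv_into (carrier A0) k) u"
    have uH: "Poly_Mapping.keys u \<subseteq> H \<times> carrier F"
    proof
      fix p assume p: "p \<in> Poly_Mapping.keys u"
      then have "i (fst p) \<in> set ys" unfolding ys by blast
      then show "p \<in> H \<times> carrier F" using p u(1) yse by (cases p) (auto simp: H_def)
    qed
    have ua: "Poly_Mapping.keys ua \<subseteq> carrier A0 \<times> carrier F"
      unfolding ua_def by (rule keys_frag_fst[OF uH]) (auto simp: k(3)[symmetric] inv_into_into)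
    have kua: "frag_fst k ua = u"
      unfolding ua_def by (rule frag_fst_id[OF uH]) (simp add: k(3) f_inv_into_f)
    have ju: "Poly_Mapping.keys (frag_fst j ua) \<subseteq> carrier N \<times> carrier F"
      by (rule keys_frag_fst[OF ua]) (use left_module_hom_facts(1)[OF j(1)] in auto)
    have eq: "frag_fst i u = frag_fst e (frag_fst j ua)"
      using frag_fst_comp_cong[OF ua, of i k "\<lambda>a. i (k a)"] frag_fst_comp_cong[OF ua, of e j "\<lambda>a. i (k a)"]
        j(2) kua by simp
    obtain w where w: "w \<in> tensor_null R N F" "frag_fst e w = frag_fst i u"
      using Yw[of N e] N e(1) yse ys by auto
    have "w = frag_fst (inv_into (carrier N) e) (frag_fst e w)"
      by (rule frag_fst_id[OF tensor_null_facts(1)[OF N FM w(1)], symmetric]) (simp add: e(2))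
    also have "\<dots> = frag_fst (inv_into (carrier N) e) (frag_fst e (frag_fst j ua))"
      using w(2) eq by simp
    also have "\<dots> = frag_fst j ua" by (rule frag_fst_id[OF ju]) (simp add: e(2))
    finally have "frag_fst j ua \<in> tensor_null R N F" using w(1) by simp
    moreover have "inj_on (tensor_map R N F j) (carrier (tensor_product R A0 F))"
      using conjunct2[OF F[unfolded flat_module_def], THEN spec, THEN spec, THEN spec, THEN mp, of A0 N j]
        A0 N j(1) jinj by simp
    ultimately have "ua \<in> tensor_null R A0 F"
      unfolding inj_on_tensor_map_iff[OF j(1) A0 N FM] using ua by blast
    then have "frag_fst k ua \<in> tensor_null R A F" by (rule tensor_null_map[OF k(1) A0 A FM])
    then show ?thesis using kua by simp
  qed
  then show ?thesis unfolding inj_on_tensor_map_iff[OF i(1) A B FM] by blast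
qed

end

theory Submission
  imports Defs "HOL-Library.Z2"
begin

text \<open>Over \<open>F\<^sub>2\<close>, let \<open>S\<close> be generated by \<open>a\<^sub>0, a\<^sub>1, \<dots>\<close> with relations \<open>a\<^sub>i a\<^sub>i\<^sub>+\<^sub>1 = 0\<close>. In this monomial
  algebra \<open>x a\<^sub>0 = 0\<close> only for \<open>x = 0\<close>, and \<open>x a\<^sub>i\<^sub>+\<^sub>1 = 0\<close> exactly for \<open>x \<in> S a\<^sub>i\<close>. So right multiplication
  by the generators gives an acyclic complex \<open>0 \<rightarrow> S \<rightarrow> S \<rightarrow> \<dots>\<close> of free left modules. It is not
  contractible since \<open>a\<^sub>0\<close> has no right inverse, and its cocycle module \<open>S a\<^sub>1\<close> is not flat: \<open>a\<^sub>0 \<otimes> a\<^sub>1\<close>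
  is nonzero in \<open>a\<^sub>0 S \<otimes> S a\<^sub>1\<close> and vanishes in \<open>S \<otimes> S a\<^sub>1\<close>. The \<open>F\<^sub>2\<close>-dual of the complex is a complex
  of injective right modules. A contraction of it would split \<open>f \<mapsto> f(- a\<^sub>0)\<close> and so send the functional
  \<open>\<epsilon>\<close> of the constant coefficient to an \<open>h\<close> with \<open>h(a\<^sub>0) = 1\<close>, although \<open>h a\<^sub>0 = 0\<close> as \<open>\<epsilon> a\<^sub>0 = 0\<close>.\<close>

section \<open>The monomial algebra\<close>

text \<open>Coefficients in \<open>bit\<close> turn identities between sets, with
  \<open>sym_diff\<close> as addition, into arithmetic in F_2 that \<open>ind_eqI\<close> lets one
  check word by word.\<close>

definition ind :: "'a set \<Rightarrow> 'a \<Rightarrow> bit"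
  where "ind x w = of_bool (w \<in> x)"

lemma ind_sym_diff: "ind (sym_diff x y) w = ind x w + ind y w"
  by (auto simp: ind_def)

lemma ind_Collect: "ind {w. P w \<and> f w = 1} w = of_bool (P w) * f w"
  by (auto simp: ind_def)

lemma ind_eqI: "(\<And>w. ind x w = ind y w) \<Longrightarrow> x = y"
  by (force simp: ind_def of_bool_def split: if_splits)

text \<open>Elements of both sets are counted twice and cancel in characteristic 2, so the sum of
  \<open>F\<close> is linear in the set.\<close>

lemma bit_sum_sym_diff:
  fixes F :: "'a \<Rightarrow> bit"
  assumes "finite x" "finite y"
  shows "(\<Sum>w\<in>sym_diff x y. F w) = (\<Sum>w\<in>x. F w) + (\<Sum>w\<in>y. F w)"
proof -
  have "(\<Sum>w\<in>x. F w) = (\<Sum>w\<in>x - y. F w) + (\<Sum>w\<in>x \<inter> y. F w)"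
    using assms by (metis add.commute sum.Int_Diff)
  moreover have "(\<Sum>w\<in>y. F w) = (\<Sum>w\<in>y - x. F w) + (\<Sum>w\<in>x \<inter> y. F w)"
    using assms by (metis add.commute sum.Int_Diff Int_commute)
  moreover have "(\<Sum>w\<in>sym_diff x y. F w) = (\<Sum>w\<in>x - y. F w) + (\<Sum>w\<in>y - x. F w)"
    using assms by (intro sum.union_disjoint) auto
  moreover have "(a + c) + (b + c) = a + b" for a b c :: bit by (cases a; cases b; cases c) auto
  ultimately show ?thesis by (simp only:)
qed

lemma bit_sum_ind:
  fixes F :: "'a \<Rightarrow> bit"
  assumes "finite T" "x \<subseteq> T"
  shows "(\<Sum>w\<in>x. F w) = (\<Sum>w\<in>T. ind x w * F w)"
proof -
  have "(\<Sum>w\<in>x. F w) = (\<Sum>w\<in>x. ind x w * F w)" by (intro sum.cong) (simp_all add: ind_def)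
  also have "\<dots> = (\<Sum>w\<in>T. ind x w * F w)"
    using assms by (intro sum.mono_neutral_left) (auto simp: ind_def)
  finally show ?thesis .
qed

section \<open>Reduced words and their products\<close>

definition reduced :: "nat list \<Rightarrow> bool"
  where "reduced w \<longleftrightarrow> successively (\<lambda>i j. j \<noteq> Suc i) w"

lemma reduced_simps [simp]: "reduced []" "reduced [i]" "reduced [i, j] \<longleftrightarrow> j \<noteq> Suc i"
  by (simp_all add: reduced_def)

lemma reduced_append:
  "reduced (u @ v) \<longleftrightarrow> reduced u \<and> reduced v \<and> (u = [] \<or> v = [] \<or> hd v \<noteq> Suc (last u))"
  by (simp add: reduced_def successively_append_iff)

text \<open>Each coefficient counts factorisations modulo 2. Concatenations that are not reduced
  contain a factor killed by the relations and are dropped.\<close>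

definition word_mult :: "nat list set \<Rightarrow> nat list set \<Rightarrow> nat list set"
  where "word_mult x y = {w. reduced w \<and> (\<Sum>u\<in>x. \<Sum>v\<in>y. of_bool (u @ v = w)) = (1 :: bit)}"

text \<open>The algebra \<open>F\<^sub>2\<langle>a\<^sub>0, a\<^sub>1, \<dots>\<rangle> / (a\<^sub>i a\<^sub>i\<^sub>+\<^sub>1)\<close>: the reduced words form a basis, and an element is the set
  of the words that occur in it.\<close>

definition word_algebra :: "nat list set ring"
  where "word_algebra = \<lparr>carrier = {x. finite x \<and> x \<subseteq> Collect reduced}, mult = word_mult,
    one = {[]}, ring.zero = {}, add = sym_diff\<rparr>"

lemma word_algebra_simps [simp]:
  "x \<in> carrier word_algebra \<longleftrightarrow> finite x \<and> x \<subseteq> Collect reduced"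
  "mult word_algebra = word_mult" "\<one>\<^bsub>word_algebra\<^esub> = {[]}" "\<zero>\<^bsub>word_algebra\<^esub> = {}"
  "add word_algebra = sym_diff"
  by (auto simp: word_algebra_def)

lemma ind_word_mult:
  "ind (word_mult x y) w = of_bool (reduced w) * (\<Sum>u\<in>x. \<Sum>v\<in>y. of_bool (u @ v = w))"
  unfolding word_mult_def by (rule ind_Collect)

lemma word_mult_subset: "word_mult x y \<subseteq> (\<lambda>(u, v). u @ v) ` (x \<times> y)"
proof
  fix w assume "w \<in> word_mult x y"
  then have "(\<Sum>u\<in>x. \<Sum>v\<in>y. of_bool (u @ v = w)) \<noteq> (0 :: bit)" by (simp add: word_mult_def)
  then obtain u where "u \<in> x" "(\<Sum>v\<in>y. of_bool (u @ v = w)) \<noteq> (0 :: bit)" by (rule sum.not_neutral_contains_not_neutral)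
  moreover from this(2) obtain v where "v \<in> y" "of_bool (u @ v = w) \<noteq> (0 :: bit)"
    by (rule sum.not_neutral_contains_not_neutral)
  ultimately show "w \<in> (\<lambda>(u, v). u @ v) ` (x \<times> y)" by (auto split: if_splits)
qed

lemma word_mult_reduced: "w \<in> word_mult x y \<Longrightarrow> reduced w"
  by (simp add: word_mult_def)

lemma word_mult_closed:
  assumes "finite x" "finite y"
  shows "finite (word_mult x y)" "word_mult x y \<subseteq> Collect reduced"
  using assms finite_subset[OF word_mult_subset[of x y]] word_mult_reduced by auto

text \<open>A functional that vanishes on the monomials in the ideal does not see the reduction of words.\<close>

lemma sum_word_mult:
  fixes F :: "nat list \<Rightarrow> bit"
  assumes x: "finite x" and y: "finite y" and F: "\<And>w. \<not> reduced w \<Longrightarrow> F w = 0"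
  shows "(\<Sum>w\<in>word_mult x y. F w) = (\<Sum>u\<in>x. \<Sum>v\<in>y. F (u @ v))"
proof -
  let ?T = "(\<lambda>(u, v). u @ v) ` (x \<times> y)"
  have T: "finite ?T" using x y by simp
  have "(\<Sum>w\<in>word_mult x y. F w) = (\<Sum>w\<in>?T. ind (word_mult x y) w * F w)"
    by (rule bit_sum_ind[OF T word_mult_subset])
  also have "\<dots> = (\<Sum>w\<in>?T. \<Sum>u\<in>x. \<Sum>v\<in>y. of_bool (u @ v = w) * F w)"
  proof (rule sum.cong[OF refl])
    fix w
    have "of_bool (reduced w) * F w = F w" using F by auto
    then show "ind (word_mult x y) w * F w = (\<Sum>u\<in>x. \<Sum>v\<in>y. of_bool (u @ v = w) * F w)"
      unfolding ind_word_mult by (simp only: sum_distrib_right[symmetric] mult.commute[of "of_bool (reduced w)"] mult.assoc)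
  qed
  also have "\<dots> = (\<Sum>u\<in>x. \<Sum>w\<in>?T. \<Sum>v\<in>y. of_bool (u @ v = w) * F w)" by (rule sum.swap)
  also have "\<dots> = (\<Sum>u\<in>x. \<Sum>v\<in>y. \<Sum>w\<in>?T. of_bool (u @ v = w) * F w)"
    by (intro sum.cong refl sum.swap)
  also have "\<dots> = (\<Sum>u\<in>x. \<Sum>v\<in>y. F (u @ v))"
  proof (intro sum.cong refl)
    fix u v assume "u \<in> x" "v \<in> y"
    then have "u @ v \<in> ?T" by auto
    moreover have "(\<Sum>w\<in>?T. of_bool (u @ v = w) * F w) = (\<Sum>w\<in>?T. if u @ v = w then F w else 0)"
      by (intro sum.cong) auto
    ultimately show "(\<Sum>w\<in>?T. of_bool (u @ v = w) * F w) = F (u @ v)"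
      using T by simp
  qed
  finally show ?thesis .
qed

text \<open>Both bracketings count, modulo 2, the triples with concatenation \<open>w\<close>. For
  reduced \<open>w\<close> the inner truncation loses nothing: factors of a reduced word are
  reduced, so \<open>sum_word_mult\<close> applies.\<close>

lemma ind_word_mult_assoc:
  assumes "finite x" "finite y" "finite z"
  shows "ind (word_mult (word_mult x y) z) w = of_bool (reduced w) *
      (\<Sum>u\<in>x. \<Sum>v\<in>y. \<Sum>t\<in>z. of_bool (u @ v @ t = w))"
    and "ind (word_mult x (word_mult y z)) w = of_bool (reduced w) *
      (\<Sum>u\<in>x. \<Sum>v\<in>y. \<Sum>t\<in>z. of_bool (u @ v @ t = w))"
proof -
  show "ind (word_mult (word_mult x y) z) w = of_bool (reduced w) *
      (\<Sum>u\<in>x. \<Sum>v\<in>y. \<Sum>t\<in>z. of_bool (u @ v @ t = w))"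
  proof (cases "reduced w")
    case True
    then have "(\<Sum>p\<in>word_mult x y. \<Sum>t\<in>z. of_bool (p @ t = w) :: bit)
      = (\<Sum>u\<in>x. \<Sum>v\<in>y. \<Sum>t\<in>z. of_bool ((u @ v) @ t = w))"
      using assms by (intro sum_word_mult sum.neutral) (auto simp: reduced_append)
    then show ?thesis by (simp add: ind_word_mult)
  qed (simp add: ind_word_mult)
  show "ind (word_mult x (word_mult y z)) w = of_bool (reduced w) *
      (\<Sum>u\<in>x. \<Sum>v\<in>y. \<Sum>t\<in>z. of_bool (u @ v @ t = w))"
  proof (cases "reduced w")
    case True
    then have "(\<Sum>q\<in>word_mult y z. of_bool (u @ q = w) :: bit)
      = (\<Sum>v\<in>y. \<Sum>t\<in>z. of_bool (u @ v @ t = w))" for u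
      using assms by (intro sum_word_mult) (auto simp: reduced_append)
    then show ?thesis by (simp add: ind_word_mult)
  qed (simp add: ind_word_mult)
qed

lemma word_mult_add_left:
  assumes "finite x" "finite y"
  shows "word_mult (sym_diff x y) z = sym_diff (word_mult x z) (word_mult y z)"
  by (rule ind_eqI) (simp only: ind_sym_diff ind_word_mult bit_sum_sym_diff[OF assms] distrib_left)

lemma word_mult_add_right:
  assumes "finite x" "finite y"
  shows "word_mult z (sym_diff x y) = sym_diff (word_mult z x) (word_mult z y)"
  by (rule ind_eqI) (simp only: ind_sym_diff ind_word_mult bit_sum_sym_diff[OF assms] distrib_left sum.distrib)

text \<open>Injectivity leaves at most one nonzero summand. Concatenation with a fixed word is
  injective, so multiplication by a single word causes no cancellation.\<close>

lemma sum_of_bool_inj: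
  assumes "finite x" "inj_on f x"
  shows "(\<Sum>u\<in>x. of_bool (f u = w) :: bit) = of_bool (w \<in> f ` x)"
proof -
  have "(\<Sum>u\<in>x. of_bool (f u = w) :: bit) = (\<Sum>p\<in>f ` x. of_bool (p = w))"
    using assms by (simp add: sum.reindex del: sum_of_bool_eq)
  also have "\<dots> = (\<Sum>p\<in>f ` x. if w = p then 1 else 0)" by (rule sum.cong) auto
  also have "\<dots> = of_bool (w \<in> f ` x)" using assms by simp
  finally show ?thesis .
qed

lemma word_mult_singleton_right:
  assumes "finite x"
  shows "word_mult x {v} = {w. reduced w \<and> (\<exists>u\<in>x. w = u @ v)}"
  using sum_of_bool_inj[OF assms, of "\<lambda>u. u @ v"]
  by (auto simp: word_mult_def inj_on_def simp del: sum_of_bool_eq)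

lemma word_mult_singleton_left:
  assumes "finite y"
  shows "word_mult {u} y = {w. reduced w \<and> (\<exists>v\<in>y. w = u @ v)}"
  using sum_of_bool_inj[OF assms, of "\<lambda>v. u @ v"]
  by (auto simp: word_mult_def inj_on_def simp del: sum_of_bool_eq)

text \<open>Characteristic 2: every element is its own inverse.\<close>

lemma abelian_group_sym_diff:
  assumes "add M = sym_diff" "\<zero>\<^bsub>M\<^esub> = {}" "{} \<in> carrier M"
    "\<And>x y. x \<in> carrier M \<Longrightarrow> y \<in> carrier M \<Longrightarrow> sym_diff x y \<in> carrier M"
  shows "abelian_group M"
proof (rule abelian_groupI)
  fix x assume "x \<in> carrier M"
  then show "\<exists>y\<in>carrier M. y \<oplus>\<^bsub>M\<^esub> x = \<zero>\<^bsub>M\<^esub>" by (intro bexI[of _ x]) (auto simp: assms)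
qed (use assms in auto)

lemma ring_word_algebra: "ring word_algebra"
proof (rule ringI)
  show "abelian_group word_algebra" by (rule abelian_group_sym_diff) auto
  show "monoid word_algebra"
  proof (rule monoidI)
    fix x y z assume *: "x \<in> carrier word_algebra" "y \<in> carrier word_algebra" "z \<in> carrier word_algebra"
    then show "x \<otimes>\<^bsub>word_algebra\<^esub> y \<in> carrier word_algebra"
      using word_mult_closed by simp
    show "x \<otimes>\<^bsub>word_algebra\<^esub> y \<otimes>\<^bsub>word_algebra\<^esub> z = x \<otimes>\<^bsub>word_algebra\<^esub> (y \<otimes>\<^bsub>word_algebra\<^esub> z)"
      using * by (intro ind_eqI) (simp add: ind_word_mult_assoc)
  qed (auto simp: word_mult_singleton_left word_mult_singleton_right)
qed (simp_all add: word_mult_add_left word_mult_add_right)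

section \<open>Modules over a general ring\<close>

lemma left_module_submodule:
  assumes M: "left_module R M" and H: "submodule H R M"
  shows "left_module R (M\<lparr>carrier := H\<rparr>)"
proof -
  interpret left_module R M by fact
  note H' = submodule_facts[OF H]
  have [simp]: "x \<in> carrier M" if "x \<in> H" for x using H'(1) that by blast
  show ?thesis
  proof (intro left_module.intro left_module_axioms.intro)
    show "abelian_group (M\<lparr>carrier := H\<rparr>)"
    proof (rule abelian_groupI)
      show "\<exists>y\<in>carrier (M\<lparr>carrier := H\<rparr>). y \<oplus>\<^bsub>M\<lparr>carrier := H\<rparr>\<^esub> x = \<zero>\<^bsub>M\<lparr>carrier := H\<rparr>\<^esub>"
        if "x \<in> carrier (M\<lparr>carrier := H\<rparr>)" for x
        using that H'(4)[of x] by (auto intro!: bexI[of _ "\<ominus>\<^bsub>M\<^esub> x"] M.l_neg)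
    qed (auto simp: H' M.a_ac)
  qed (auto simp: H' smult_l_distr smult_r_distr smult_assoc1 R.ring_axioms)
qed

lemma opposite_ring_simps [simp]:
  "carrier (opposite_ring R) = carrier R" "x \<otimes>\<^bsub>opposite_ring R\<^esub> y = y \<otimes>\<^bsub>R\<^esub> x"
  "\<one>\<^bsub>opposite_ring R\<^esub> = \<one>\<^bsub>R\<^esub>" "\<zero>\<^bsub>opposite_ring R\<^esub> = \<zero>\<^bsub>R\<^esub>"
  "add (opposite_ring R) = add R"
  by (simp_all add: opposite_ring_def)

lemma ring_opposite_ring:
  assumes "ring R"
  shows "ring (opposite_ring R)"
proof -
  interpret ring R by fact
  show ?thesis
  proof (rule ringI)
    show "abelian_group (opposite_ring R)"
      by (rule abelian_groupI) (auto simp: a_ac intro: l_neg)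
    show "monoid (opposite_ring R)" by (rule monoidI) (auto simp: m_assoc)
  qed (auto simp: l_distr r_distr)
qed

lemma regular_module_simps [simp]:
  "carrier (regular_module R) = carrier R" "\<zero>\<^bsub>regular_module R\<^esub> = \<zero>\<^bsub>R\<^esub>"
  "add (regular_module R) = add R" "smult (regular_module R) = mult R"
  by (simp_all add: regular_module_def)

section \<open>Left ideals generated by an idempotent\<close>

text \<open>For idempotent \<open>e\<close> this is the left ideal Re. The choices 1 and 0 yield the
  free module of rank one and the zero module, so one set of lemmas serves all terms of the
  complex.\<close>

definition idempotent_ideal :: "('a, 'm) ring_scheme \<Rightarrow> 'a \<Rightarrow> ('a, 'a) module"
  where "idempotent_ideal R e = (regular_module R)\<lparr>carrier := {x \<in> carrier R. x \<otimes>\<^bsub>R\<^esub> e = x}\<rparr>"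

lemma idempotent_ideal_simps [simp]:
  "carrier (idempotent_ideal R e) = {x \<in> carrier R. x \<otimes>\<^bsub>R\<^esub> e = x}"
  "\<zero>\<^bsub>idempotent_ideal R e\<^esub> = \<zero>\<^bsub>R\<^esub>" "add (idempotent_ideal R e) = add R"
  "smult (idempotent_ideal R e) = mult R"
  by (simp_all add: idempotent_ideal_def)

context
  fixes R :: "('a, 'm) ring_scheme" and e
  assumes R: "ring R" and e: "e \<in> carrier R" "e \<otimes>\<^bsub>R\<^esub> e = e"
begin

interpretation ring R by (rule R)

lemma left_module_idempotent_ideal: "left_module R (idempotent_ideal R e)"
  unfolding idempotent_ideal_def
  by (intro left_module_submodule submodule_of_left_moduleI left_module_regular R)
    (auto simp: e l_distr m_assoc)

text \<open>The single generator is \<open>e\<close>, since x = xe for every element x.\<close>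

lemma finitely_generated_idempotent_ideal: "finitely_generated R (idempotent_ideal R e)"
proof -
  have "N = carrier (idempotent_ideal R e)"
    if N: "submodule N R (idempotent_ideal R e)" and "{e} \<subseteq> N" for N
  proof
    show "N \<subseteq> carrier (idempotent_ideal R e)" by (rule submodule_facts(1)[OF N])
    show "carrier (idempotent_ideal R e) \<subseteq> N"
    proof
      fix x assume "x \<in> carrier (idempotent_ideal R e)"
      then show "x \<in> N" using submodule_facts(5)[OF N, of x e] that(2) by simp
    qed
  qed
  then show ?thesis
    unfolding finitely_generated_def using left_module_idempotent_ideal e
    by (intro conjI exI[of _ "{e}"]) auto
qed

text \<open>A homomorphism \<open>g\<close> on Re is determined by \<open>g e\<close>. A preimage
  \<open>b\<close> of \<open>g e\<close> gives the lift that sends x to xb, since p(xb) = x g(e) =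
  g(xe) = g(x).\<close>

lemma projective_module_idempotent_ideal: "projective_module R (idempotent_ideal R e)"
  unfolding projective_module_def
proof (intro conjI allI impI left_module_idempotent_ideal)
  fix B C :: "('a, ('a, 'a) test) module" and p g
  assume *: "left_module R B \<and> left_module R C \<and> p \<in> left_module_hom R B C \<and>
    p ` carrier B = carrier C \<and> g \<in> left_module_hom R (idempotent_ideal R e) C"
  then have p: "p \<in> left_module_hom R B C" and g: "g \<in> left_module_hom R (idempotent_ideal R e) C"
    by auto
  interpret B: left_module R B using * by blast
  have "g e \<in> carrier C" using left_module_hom_facts(1)[OF g] e by simp
  then have "g e \<in> p ` carrier B" using * by simp
  then obtain b where b: "b \<in> carrier B" "p b = g e" by (metis imageE)
  have "(\<lambda>x. x \<odot>\<^bsub>B\<^esub> b) \<in> left_module_hom R (idempotent_ideal R e) B"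
    using b(1) by (auto simp: left_module_hom_def B.smult_l_distr B.smult_assoc1)
  moreover have "p (x \<odot>\<^bsub>B\<^esub> b) = g x" if "x \<in> carrier (idempotent_ideal R e)" for x
  proof -
    have x: "x \<in> carrier R" "x \<otimes>\<^bsub>R\<^esub> e = x" using that by auto
    have "p (x \<odot>\<^bsub>B\<^esub> b) = x \<odot>\<^bsub>C\<^esub> g e"
      using left_module_hom_facts(3)[OF p x(1) b(1)] b(2) by simp
    also have "\<dots> = g (x \<otimes>\<^bsub>R\<^esub> e)"
      using left_module_hom_facts(3)[OF g x(1), of e] e by simp
    finally show ?thesis unfolding x(2) .
  qed
  ultimately show "\<exists>h\<in>left_module_hom R (idempotent_ideal R e) B.
      \<forall>x\<in>carrier (idempotent_ideal R e). p (h x) = g x"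
    by (intro bexI[of _ "\<lambda>x. x \<odot>\<^bsub>B\<^esub> b"] ballI)
qed

end

section \<open>Tensor products and flatness\<close>

text \<open>A balanced biadditive map induces a homomorphism on the tensor product, so a nontrivial
  value certifies that a tensor does not vanish.\<close>

lemma tensor_null_balanced:
  assumes A: "right_module R A" and F: "left_module R F" and G: "comm_group G"
    and closed: "\<And>a x. a \<in> carrier A \<Longrightarrow> x \<in> carrier F \<Longrightarrow> f a x \<in> carrier G"
    and add_left: "\<And>a b x. a \<in> carrier A \<Longrightarrow> b \<in> carrier A \<Longrightarrow> x \<in> carrier F \<Longrightarrow>
      f (a \<oplus>\<^bsub>A\<^esub> b) x = f a x \<otimes>\<^bsub>G\<^esub> f b x"
    and add_right: "\<And>a x y. a \<in> carrier A \<Longrightarrow> x \<in> carrier F \<Longrightarrow> y \<in> carrier F \<Longrightarrow>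
      f a (x \<oplus>\<^bsub>F\<^esub> y) = f a x \<otimes>\<^bsub>G\<^esub> f a y"
    and balanced: "\<And>r a x. r \<in> carrier R \<Longrightarrow> a \<in> carrier A \<Longrightarrow> x \<in> carrier F \<Longrightarrow>
      f (r \<odot>\<^bsub>A\<^esub> a) x = f a (r \<odot>\<^bsub>F\<^esub> x)"
    and a: "a \<in> carrier A" "x \<in> carrier F" "frag_of (a, x) \<in> tensor_null R A F"
  shows "f a x = \<one>\<^bsub>G\<^esub>"
proof -
  interpret G: comm_group G by fact
  interpret A: left_module "opposite_ring R" A by fact
  interpret F: left_module R F by fact
  let ?S = "carrier A \<times> carrier F"
  have "(\<lambda>(a, x). f a x) ` ?S \<subseteq> carrier G" using closed by auto
  then obtain h where h: "h \<in> hom (free_Abelian_group ?S) G"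
      "\<And>p. p \<in> ?S \<Longrightarrow> h (frag_of p) = (\<lambda>(a, x). f a x) p"
    by (rule G.free_Abelian_group_universal) (rule that)
  have hf: "h (frag_of (a, x)) = f a x" if "a \<in> carrier A" "x \<in> carrier F" for a x
    using h(2)[of "(a, x)"] that by simp
  interpret h: group_hom "free_Abelian_group ?S" G h
    by (simp add: group_hom_def group_hom_axioms_def h(1) G.is_group)
  have add: "h (u + v) = h u \<otimes>\<^bsub>G\<^esub> h v" if "Poly_Mapping.keys u \<subseteq> ?S" "Poly_Mapping.keys v \<subseteq> ?S" for u v
    using h.hom_mult[of u v] that by simp
  have key: "Poly_Mapping.keys (frag_of (a, x)) \<subseteq> ?S" if "a \<in> carrier A" "x \<in> carrier F" for a x
    using that by simp
  \<comment> \<open>Every relation is a difference. Adding back the subtracted terms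
    \<open>v\<close> reduces the claim to additivity or balancing of \<open>f\<close>, with no
    inverses in \<open>G\<close> to compute.\<close>
  have ker: "h u = \<one>\<^bsub>G\<^esub>"
    if u: "Poly_Mapping.keys u \<subseteq> ?S" and v: "Poly_Mapping.keys v \<subseteq> ?S" and "h (u + v) = h v" for u v
    using add[OF u v] that h.hom_closed[of u] h.hom_closed[of v] by simp
  have "tensor_relations R A F \<subseteq> kernel (free_Abelian_group ?S) G h"
  proof
    fix u assume u: "u \<in> tensor_relations R A F"
    have k: "Poly_Mapping.keys u \<subseteq> ?S" by (rule tensor_relations_keys[OF A F u])
    have "h u = \<one>\<^bsub>G\<^esub>"
      using u
    proof (cases rule: tensor_relationsE)
      case (1 a b x)
      have kk: "Poly_Mapping.keys (frag_of (a, x) + frag_of (b, x)) \<subseteq> ?S"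
        using keys_add[of "frag_of (a, x)" "frag_of (b, x)"] 1 by auto
      show ?thesis
        by (rule ker[OF k kk]) (use 1 in \<open>simp add: add key hf add_left\<close>)
    next
      case (2 a x y)
      have kk: "Poly_Mapping.keys (frag_of (a, x) + frag_of (a, y)) \<subseteq> ?S"
        using keys_add[of "frag_of (a, x)" "frag_of (a, y)"] 2 by auto
      show ?thesis
        by (rule ker[OF k kk]) (use 2 in \<open>simp add: add key hf add_right\<close>)
    next
      case (3 r a x)
      have kk: "Poly_Mapping.keys (frag_of (a, r \<odot>\<^bsub>F\<^esub> x)) \<subseteq> ?S" using 3 by simp
      show ?thesis
        by (rule ker[OF k kk]) (use 3 A.smult_closed[of r a] in \<open>simp add: hf balanced\<close>)
    qed
    then show "u \<in> kernel (free_Abelian_group ?S) G h" using k by (simp add: kernel_def)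
  qed
  then have "tensor_null R A F \<subseteq> kernel (free_Abelian_group ?S) G h"
    unfolding tensor_null_def by (intro h.generate_subgroup_incl h.subgroup_kernel)
  then show ?thesis using a hf by (auto simp: kernel_def)
qed

text \<open>Every element of A \<otimes> Re has the form a \<otimes> e, and it is zero if and only
  if ae = 0. Since i(a)e = i(ae), injectivity of \<open>i\<close> survives tensoring.\<close>

lemma flat_module_idempotent_ideal:
  fixes R :: "('a, 'm) ring_scheme"
  assumes R: "ring R" and e: "e \<in> carrier R" "e \<otimes>\<^bsub>R\<^esub> e = e"
  shows "flat_module R (idempotent_ideal R e)"
proof -
  let ?F = "idempotent_ideal R e"
  interpret R: ring R by fact
  note F = left_module_idempotent_ideal[OF assms]
  show ?thesis
    unfolding flat_module_def
  proof (intro conjI allI impI F)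
    fix A B :: "('a, ('a, 'a) test) module" and i
    assume *: "right_module R A \<and> right_module R B \<and> i \<in> left_module_hom (opposite_ring R) A B \<and>
      inj_on i (carrier A)"
    then have A: "right_module R A" and B: "right_module R B"
      and i: "i \<in> left_module_hom (opposite_ring R) A B" and inj: "inj_on i (carrier A)" by auto
    interpret A: left_module "opposite_ring R" A by fact
    interpret B: left_module "opposite_ring R" B by fact
    note An = tensor_null_facts[OF A F] and Bn = tensor_null_facts[OF B F]
    have null_minus: "u - v \<in> tensor_null R A ?F"
      if "u \<in> tensor_null R A ?F" "v \<in> tensor_null R A ?F" for u v
      using An(3)[OF that(1) An(4)[OF that(2)]] by simp
    have rel: "u \<in> tensor_null R A ?F" if "u \<in> tensor_relations R A ?F" for u
      unfolding tensor_null_def by (rule generate.incl[OF that])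
    have r1: "frag_of (a \<oplus>\<^bsub>A\<^esub> b, e) - frag_of (a, e) - frag_of (b, e) \<in> tensor_null R A ?F"
      if "a \<in> carrier A" "b \<in> carrier A" for a b
      using that e by (intro rel) (auto simp: tensor_relations_def)
    have r3: "frag_of (r \<odot>\<^bsub>A\<^esub> a, e) - frag_of (a, r \<otimes>\<^bsub>R\<^esub> e) \<in> tensor_null R A ?F"
      if "r \<in> carrier R" "a \<in> carrier A" for r a
    proof (rule rel)
      have "frag_of (r \<odot>\<^bsub>A\<^esub> a, e) - frag_of (a, r \<odot>\<^bsub>?F\<^esub> e) \<in> tensor_relations R A ?F"
        unfolding tensor_relations_def using that e by simp blast
      then show "frag_of (r \<odot>\<^bsub>A\<^esub> a, e) - frag_of (a, r \<otimes>\<^bsub>R\<^esub> e) \<in> tensor_relations R A ?F" by simp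
    qed
    \<comment> \<open>The additivity relation for 0 + 0 = 0 is minus the tensor 0 \<otimes>
      e.\<close>
    have null_zero: "frag_of (\<zero>\<^bsub>A\<^esub>, e) \<in> tensor_null R A ?F"
      using An(4)[OF r1[of "\<zero>\<^bsub>A\<^esub>" "\<zero>\<^bsub>A\<^esub>"]] by simp
    \<comment> \<open>On generators a \<otimes> x = a \<otimes> xe = ax \<otimes> e, and differences
      combine in the first factor.\<close>
    have red: "\<exists>a\<in>carrier A. u - frag_of (a, e) \<in> tensor_null R A ?F"
      if "Poly_Mapping.keys u \<subseteq> carrier A \<times> carrier ?F" for u
      using that
    proof (induction u rule: frag_induction)
      case zero
      show ?case using An(4)[OF null_zero] by (intro bexI[of _ "\<zero>\<^bsub>A\<^esub>"]) auto
    next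
      case (one p)
      then obtain a x where p: "p = (a, x)" "a \<in> carrier A" "x \<in> carrier R" "x \<otimes>\<^bsub>R\<^esub> e = x" by auto
      then have "frag_of p - frag_of (x \<odot>\<^bsub>A\<^esub> a, e) \<in> tensor_null R A ?F"
        using An(4)[OF r3[of x a]] by simp
      moreover have "x \<odot>\<^bsub>A\<^esub> a \<in> carrier A" using p A.smult_closed[of x a] by simp
      ultimately show ?case by blast
    next
      case (diff u v)
      then obtain a b where ab: "a \<in> carrier A" "u - frag_of (a, e) \<in> tensor_null R A ?F"
        "b \<in> carrier A" "v - frag_of (b, e) \<in> tensor_null R A ?F" by blast
      let ?c = "a \<ominus>\<^bsub>A\<^esub> b"
      have c: "?c \<in> carrier A" "?c \<oplus>\<^bsub>A\<^esub> b = a" using ab by (auto simp: A.M.minus_eq A.M.a_assoc A.M.l_neg)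
      have "(u - frag_of (a, e)) - (v - frag_of (b, e)) + (frag_of (a, e) - frag_of (?c, e) - frag_of (b, e))
        \<in> tensor_null R A ?F"
        using An(3)[OF null_minus[OF ab(2,4)] r1[OF c(1) ab(3)]] c by simp
      then have "(u - v) - frag_of (?c, e) \<in> tensor_null R A ?F" by (simp add: algebra_simps)
      then show ?case using c by blast
    qed
    show "inj_on (tensor_map R B ?F i) (carrier (tensor_product R A ?F))"
      unfolding inj_on_tensor_map_iff[OF i A B F]
    proof (intro allI impI)
      fix u assume u: "Poly_Mapping.keys u \<subseteq> carrier A \<times> carrier ?F \<and> frag_fst i u \<in> tensor_null R B ?F"
      then obtain a where a: "a \<in> carrier A" "u - frag_of (a, e) \<in> tensor_null R A ?F" using red by blast
      have ia: "i a \<in> carrier B" using left_module_hom_facts(1)[OF i a(1)] .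
      have "frag_fst i u - frag_of (i a, e) \<in> tensor_null R B ?F"
        using tensor_null_map[OF i A B F a(2)] by simp
      then have "frag_fst i u + - (frag_fst i u - frag_of (i a, e)) \<in> tensor_null R B ?F"
        using u by (intro Bn(3) Bn(4)) auto
      then have "frag_of (i a, e) \<in> tensor_null R B ?F" by simp
      \<comment> \<open>The balanced map that sends b \<otimes> x to bx, with values in the additive
        group of \<open>B\<close>, shows that i(a)e = 0.\<close>
      then have "e \<odot>\<^bsub>B\<^esub> i a = \<one>\<^bsub>add_monoid B\<^esub>"
      proof (intro tensor_null_balanced[OF B F B.M.a_comm_group, of "\<lambda>b x. x \<odot>\<^bsub>B\<^esub> b"])
        fix r b x assume "r \<in> carrier R" "b \<in> carrier B" "x \<in> carrier ?F"
        then show "x \<odot>\<^bsub>B\<^esub> (r \<odot>\<^bsub>B\<^esub> b) = (r \<odot>\<^bsub>?F\<^esub> x) \<odot>\<^bsub>B\<^esub> b"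
          using B.smult_assoc1[of x r b] by simp
      next
        fix b x y assume "b \<in> carrier B" "x \<in> carrier ?F" "y \<in> carrier ?F"
        then show "(x \<oplus>\<^bsub>?F\<^esub> y) \<odot>\<^bsub>B\<^esub> b = (x \<odot>\<^bsub>B\<^esub> b) \<otimes>\<^bsub>add_monoid B\<^esub> (y \<odot>\<^bsub>B\<^esub> b)"
          using B.smult_l_distr[of x y b] by simp
      qed (use e ia B.smult_closed in \<open>auto simp: B.smult_r_distr\<close>)
      moreover have ea: "e \<odot>\<^bsub>A\<^esub> a \<in> carrier A" using A.smult_closed[of e a] a e by simp
      moreover have "i (e \<odot>\<^bsub>A\<^esub> a) = e \<odot>\<^bsub>B\<^esub> i a" using left_module_hom_facts(3)[OF i _ a(1), of e] e by simp
      ultimately have "i (e \<odot>\<^bsub>A\<^esub> a) = i \<zero>\<^bsub>A\<^esub>" using left_module_hom_zero[OF A B i] by simp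
      then have "e \<odot>\<^bsub>A\<^esub> a = \<zero>\<^bsub>A\<^esub>" using inj ea by (auto dest: inj_onD)
      \<comment> \<open>Now a \<otimes> e = ae \<otimes> e = 0 \<otimes> e.\<close>
      then have "frag_of (\<zero>\<^bsub>A\<^esub>, e) - frag_of (a, e) \<in> tensor_null R A ?F"
        using r3[OF e(1) a(1)] e by simp
      from null_minus[OF null_zero this] have "frag_of (a, e) \<in> tensor_null R A ?F" by simp
      from An(3)[OF a(2) this] show "u \<in> tensor_null R A ?F" by simp
    qed
  qed
qed

section \<open>The complex of projective modules\<close>

abbreviation "\<S> \<equiv> word_algebra"

section \<open>Annihilators of the generators\<close>

text \<open>Appending a letter is injective, so no terms cancel; the only words lost are those whose
  last letter has successor \<open>k\<close>.\<close>

lemma word_mult_generator: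
  assumes "x \<in> carrier \<S>"
  shows "word_mult x {[k]} = (\<lambda>u. u @ [k]) ` {u \<in> x. u = [] \<or> k \<noteq> Suc (last u)}"
  using assms by (auto simp: word_mult_singleton_right reduced_append)

lemma word_mult_generator_closed:
  assumes "x \<in> carrier \<S>"
  shows "word_mult x {[k]} \<in> carrier \<S>"
  using assms word_mult_closed by simp

text \<open>No letter has successor 0, so appending 0 loses no word.\<close>

lemma word_mult_generator_0:
  assumes "x \<in> carrier \<S>"
  shows "word_mult x {[0]} = {} \<longleftrightarrow> x = {}"
  using word_mult_generator[OF assms] by auto

text \<open>An element is killed when all of its words end in \<open>k\<close>. Removing this letter
  gives the preimage, as prefixes of reduced words are reduced.\<close>

lemma word_mult_generator_Suc:
  assumes x: "x \<in> carrier \<S>"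
  shows "word_mult x {[Suc k]} = {} \<longleftrightarrow> x \<in> (\<lambda>y. word_mult y {[k]}) ` carrier \<S>"
proof
  assume "x \<in> (\<lambda>y. word_mult y {[k]}) ` carrier \<S>"
  then obtain y where y: "y \<in> carrier \<S>" "x = word_mult y {[k]}" by blast
  show "word_mult x {[Suc k]} = {}"
    unfolding word_mult_generator[OF x] unfolding y(2) word_mult_generator[OF y(1)] by auto
next
  assume "word_mult x {[Suc k]} = {}"
  then have *: "u \<noteq> [] \<and> last u = k" if "u \<in> x" for u
    using that unfolding word_mult_generator[OF x] by auto
  then have snoc: "butlast u @ [k] = u" if "u \<in> x" for u
    using that append_butlast_last_id by blast
  have y: "butlast ` x \<in> carrier \<S>"
  proof -
    have "reduced (butlast u)" if "u \<in> x" for u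
    proof -
      have "reduced (butlast u @ [k])" using snoc[OF that] x that by auto
      then show ?thesis by (simp add: reduced_append)
    qed
    then show ?thesis using x by auto
  qed
  have "word_mult (butlast ` x) {[k]} = {w. reduced w \<and> (\<exists>u\<in>x. w = butlast u @ [k])}"
    using y by (simp add: word_mult_singleton_right)
  also have "\<dots> = x" using snoc x by auto
  finally show "x \<in> (\<lambda>y. word_mult y {[k]}) ` carrier \<S>" using y by (metis imageI)
qed

section \<open>The complex and its exactness\<close>

text \<open>\<open>{[]}\<close> is the unit and \<open>{}\<close> is zero, so the terms are free of
  rank one in degrees \<ge> 0 and zero below.\<close>

definition proj_complex :: "int \<Rightarrow> (nat list set, nat list set) module"
  where "proj_complex n = idempotent_ideal \<S> (if 0 \<le> n then {[]} else {})"

text \<open>For negative \<open>n\<close> the index \<open>nat n\<close> is 0; the source is then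
  the zero module, so any letter would give the zero map.\<close>

definition proj_diff :: "int \<Rightarrow> nat list set \<Rightarrow> nat list set"
  where "proj_diff n x = word_mult x {[nat n]}"

lemma word_mult_empty [simp]: "word_mult {} x = {}" "word_mult x {} = {}"
  by (simp_all add: word_mult_def)

lemma word_mult_Nil:
  assumes "x \<in> carrier \<S>"
  shows "word_mult x {[]} = x" "word_mult {[]} x = x"
  using assms by (auto simp: word_mult_singleton_right word_mult_singleton_left)

lemma proj_complex_simps [simp]:
  "carrier (proj_complex n) = (if 0 \<le> n then carrier \<S> else {{}})"
  "\<zero>\<^bsub>proj_complex n\<^esub> = {}" "add (proj_complex n) = sym_diff" "smult (proj_complex n) = word_mult"
  by (auto simp: proj_complex_def word_mult_Nil)

lemma proj_idempotent:
  "(if 0 \<le> n then {[]} else {}) \<in> carrier \<S>"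
  "(if 0 \<le> n then {[]} else {}) \<otimes>\<^bsub>\<S>\<^esub> (if 0 \<le> n then {[]} else {}) = (if 0 \<le> n then {[]} else {})"
  using word_mult_Nil[of "{[]}"] by auto

lemma proj_complex_left_module: "left_module \<S> (proj_complex n)"
  unfolding proj_complex_def
  by (rule left_module_idempotent_ideal[OF ring_word_algebra proj_idempotent])

lemma proj_complex_finitely_generated: "finitely_generated \<S> (proj_complex n)"
  unfolding proj_complex_def
  by (rule finitely_generated_idempotent_ideal[OF ring_word_algebra proj_idempotent])

lemma proj_complex_projective: "projective_module \<S> (proj_complex n)"
  unfolding proj_complex_def
  by (rule projective_module_idempotent_ideal[OF ring_word_algebra proj_idempotent])

lemma proj_complex_flat: "flat_module \<S> (proj_complex n)"
  unfolding proj_complex_def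
  by (rule flat_module_idempotent_ideal[OF ring_word_algebra proj_idempotent])

lemma proj_complex_subset: "x \<in> carrier (proj_complex n) \<Longrightarrow> x \<in> carrier \<S>"
  by (simp split: if_splits)

lemma proj_diff_closed:
  "x \<in> carrier (proj_complex n) \<Longrightarrow> proj_diff n x \<in> carrier (proj_complex (n + 1))"
  using word_mult_generator_closed[of x "nat n"] by (auto simp: proj_diff_def split: if_splits)

lemma proj_diff_hom: "proj_diff n \<in> left_module_hom \<S> (proj_complex n) (proj_complex (n + 1))"
proof -
  interpret ring \<S> by (rule ring_word_algebra)
  have "proj_diff n (sym_diff x y) = sym_diff (proj_diff n x) (proj_diff n y)"
    if "x \<in> carrier (proj_complex n)" "y \<in> carrier (proj_complex n)" for x y
    using proj_complex_subset[OF that(1)] proj_complex_subset[OF that(2)] word_mult_add_left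
    by (simp add: proj_diff_def)
  moreover have "proj_diff n (word_mult r x) = word_mult r (proj_diff n x)"
    if "r \<in> carrier \<S>" "x \<in> carrier (proj_complex n)" for r x
    using m_assoc[of r x "{[nat n]}"] that(1) proj_complex_subset[OF that(2)] by (simp add: proj_diff_def)
  ultimately show ?thesis
    unfolding left_module_hom_def using proj_diff_closed by (simp del: proj_complex_simps(1) word_algebra_simps(1))
qed

text \<open>Below degree 0 both sides are zero. In degree 0 the claim is that right multiplication
  by a_0 is injective, and in degree k + 1 that x a_(k+1) = 0 exactly for x in S a_k.\<close>

lemma proj_cocycles:
  "{x \<in> carrier (proj_complex n). proj_diff n x = {}} = proj_diff (n - 1) ` carrier (proj_complex (n - 1))"
proof -
  consider "n < 0" | "n = 0" | k where "n = int (Suc k)"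
    by (metis less_linear zero_less_imp_eq_int Suc_pred)
  then show ?thesis
  proof cases
    case 1
    then show ?thesis by (auto simp: proj_diff_def)
  next
    case 2
    then show ?thesis using word_mult_generator_0 by (auto simp: proj_diff_def)
  next
    case 3
    then have [simp]: "nat (n - 1) = k" "nat n = Suc k" "0 \<le> n" "0 < n" "1 \<le> n" by auto
    show ?thesis
      using word_mult_generator_Suc[of _ k] word_mult_generator_closed[of _ k]
      by (auto simp: proj_diff_def simp del: word_algebra_simps(1))
  qed
qed

lemma proj_acyclic: "acyclic_complex \<S> proj_complex proj_diff"
proof -
  \<comment> \<open>Exactness already contains that the differential squares to zero: images are
    cocycles.\<close>
  have "proj_diff (n + 1) (proj_diff n x) = {}" if "x \<in> carrier (proj_complex n)" for n x
    using proj_cocycles[of "n + 1"] that by auto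
  then show ?thesis
    unfolding acyclic_complex_def cochain_complex_def
    using proj_complex_left_module proj_diff_hom proj_cocycles by (simp add: cocycles_def del: proj_complex_simps(1))
qed

lemma proj_bounded_below: "bounded_below proj_complex"
  unfolding bounded_below_def by (rule exI[of _ 0]) simp

text \<open>The homotopy into degree -1 is zero, so degree 0 would give 1 = h(a_0) = a_0 h(1). Every
  word in a_0 h(1) starts with the letter 0, which the empty word does not.\<close>

lemma proj_not_contractible: "\<not> contractible_complex \<S> proj_complex proj_diff"
proof
  assume "contractible_complex \<S> proj_complex proj_diff"
  then obtain h where h: "\<And>n. h n \<in> left_module_hom \<S> (proj_complex n) (proj_complex (n - 1))"
    and eq: "\<And>n x. x \<in> carrier (proj_complex n) \<Longrightarrow> x \<ominus>\<^bsub>proj_complex n\<^esub> \<zero>\<^bsub>proj_complex n\<^esub> =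
      proj_diff (n - 1) (h n x) \<oplus>\<^bsub>proj_complex n\<^esub> h (n + 1) (proj_diff n x)"
    unfolding contractible_complex_def chain_homotopic_def by blast
  interpret P: left_module \<S> "proj_complex 0" by (rule proj_complex_left_module)
  have "{[]} \<ominus>\<^bsub>proj_complex 0\<^esub> \<zero>\<^bsub>proj_complex 0\<^esub> = {[]}"
    using P.M.r_zero[of "{[]}"] P.M.add.inv_one by (simp add: P.M.minus_eq a_inv_def)
  moreover have "h 0 {[]} = {}" using left_module_hom_facts(1)[OF h[of 0], of "{[]}"] by simp
  moreover have "proj_diff 0 {[]} = {[0]}"
    using word_mult_Nil(2)[of "{[0]}"] by (simp add: proj_diff_def)
  ultimately have "{[]} = h 1 {[0]}" using eq[of "{[]}" 0] by (simp add: proj_diff_def)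
  also have "\<dots> = h 1 (word_mult {[0]} {[]})" using word_mult_Nil(1)[of "{[0]}"] by simp
  also have "\<dots> = word_mult {[0]} (h 1 {[]})"
    using left_module_hom_facts(3)[OF h[of 1], of "{[0]}" "{[]}"] by simp
  finally show False
    using word_mult_subset[of "{[0]}" "h 1 {[]}"] by auto
qed

section \<open>Failure of flatness of the cocycles\<close>

lemma sum_ind:
  assumes "finite x"
  shows "(\<Sum>u\<in>x. of_bool (u = p)) = ind x p"
  using sum_of_bool_inj[OF assms, of "\<lambda>u. u" p] by (simp add: ind_def)

text \<open>A one-letter word has just two factorisations and is always reduced. The result is a
  Leibniz rule for the coefficient of a letter.\<close>

lemma ind_word_mult_letter:
  assumes "finite x" "finite y"
  shows "ind (word_mult x y) [k] = ind x [] * ind y [k] + ind x [k] * ind y []"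
proof -
  have "of_bool (u @ v = [k]) = of_bool (u = []) * of_bool (v = [k]) + (of_bool (u = [k]) * of_bool (v = []) :: bit)"
    for u v by (auto simp: append_eq_Cons_conv)
  then have "ind (word_mult x y) [k] =
    (\<Sum>u\<in>x. \<Sum>v\<in>y. of_bool (u = []) * of_bool (v = [k]) + of_bool (u = [k]) * of_bool (v = []))"
    by (simp only: ind_word_mult reduced_simps of_bool_eq(2) mult_1_left)
  also have "\<dots> = (\<Sum>u\<in>x. of_bool (u = [])) * (\<Sum>v\<in>y. of_bool (v = [k])) +
      (\<Sum>u\<in>x. of_bool (u = [k])) * (\<Sum>v\<in>y. of_bool (v = []))"
    by (simp only: sum.distrib sum_product)
  finally show ?thesis by (simp only: sum_ind assms)
qed

text \<open>This is the right ideal a_0 S: right multiplication does not change the first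
  letter.\<close>

lemma submodule_right_ideal_0:
  "submodule {x \<in> carrier \<S>. \<forall>w\<in>x. w \<noteq> [] \<and> hd w = 0} (opposite_ring \<S>) (regular_module (opposite_ring \<S>))"
proof (rule submodule_of_left_moduleI[OF left_module_regular[OF ring_opposite_ring[OF ring_word_algebra]]])
  fix r x assume *: "r \<in> carrier (opposite_ring \<S>)" "x \<in> {x \<in> carrier \<S>. \<forall>w\<in>x. w \<noteq> [] \<and> hd w = 0}"
  then have "word_mult x r \<in> carrier \<S>" using word_mult_closed by simp
  moreover have "w \<noteq> [] \<and> hd w = 0" if "w \<in> word_mult x r" for w
  proof -
    have "w \<in> (\<lambda>(u, v). u @ v) ` (x \<times> r)" using that word_mult_subset by blast
    then show ?thesis using * by auto
  qed
  ultimately show "r \<odot>\<^bsub>regular_module (opposite_ring \<S>)\<^esub> x \<in> {x \<in> carrier \<S>. \<forall>w\<in>x. w \<noteq> [] \<and> hd w = 0}"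
    by (simp del: word_algebra_simps(1))
qed auto

lemma proj_not_pure_acyclic: "\<not> pure_acyclic_complex \<S> proj_complex proj_diff"
proof
  define A where "A = (regular_module (opposite_ring \<S>))\<lparr>carrier :=
    {x \<in> carrier \<S>. \<forall>w\<in>x. w \<noteq> [] \<and> hd w = 0}\<rparr>"
  define B where "B = regular_module (opposite_ring \<S>)"
  \<comment> \<open>The cocycles in degree 2 are the elements killed by right multiplication by a_2,
    that is S a_1.\<close>
  define F where "F = cocycles proj_complex proj_diff 2"
  assume "pure_acyclic_complex \<S> proj_complex proj_diff"
  then have flat: "flat_module \<S> F" unfolding pure_acyclic_complex_def F_def by blast
  then have F: "left_module \<S> F" by (simp add: flat_module_def)
  note regular = left_module_regular[OF ring_opposite_ring[OF ring_word_algebra]]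
  have B: "right_module \<S> B" unfolding B_def by (rule regular)
  have A: "right_module \<S> A"
    unfolding A_def by (rule left_module_submodule[OF regular submodule_right_ideal_0])
  have A_simps [simp]: "carrier A = {x \<in> carrier \<S>. \<forall>w\<in>x. w \<noteq> [] \<and> hd w = 0}"
      "add A = sym_diff" "smult A = (\<lambda>r a. word_mult a r)"
    by (simp_all add: A_def fun_eq_iff)
  have B_simps [simp]: "carrier B = carrier \<S>" "smult B = (\<lambda>r a. word_mult a r)" "add B = sym_diff"
    by (simp_all add: B_def fun_eq_iff)
  have F_carrier: "carrier F = {x \<in> carrier \<S>. word_mult x {[2]} = {}}"
    by (simp add: F_def cocycles_def proj_diff_def del: word_algebra_simps(1))
  have F_simps [simp]: "add F = sym_diff" "smult F = word_mult" "\<zero>\<^bsub>F\<^esub> = {}"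
    by (simp_all add: F_def cocycles_def)
  \<comment> \<open>Elements of S a_1 have no constant term. This and \<open>A_S\<close> leave a
    single summand in each use of the Leibniz rule below.\<close>
  have F_S: "finite x" "[] \<notin> x" if "x \<in> carrier F" for x
    using that word_mult_generator[of x 2] unfolding F_carrier by auto
  have A_S: "finite a" "[] \<notin> a" if "a \<in> carrier A" for a using that by auto
  have a1: "{[1]} \<in> carrier F" using word_mult_generator[of "{[1]}" 2] unfolding F_carrier by auto
  have a0: "{[0]} \<in> carrier A" by simp
  have i: "(\<lambda>x. x) \<in> left_module_hom (opposite_ring \<S>) A B" by (auto simp: left_module_hom_def)
  let ?u = "frag_of ({[0]}, {[1 :: nat]})"
  \<comment> \<open>In S \<otimes> S a_1 the factor a_0 moves across: a_0 \<otimes> a_1 = 1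
    \<otimes> a_0 a_1 = 1 \<otimes> 0.\<close>
  have "?u \<in> tensor_null \<S> B F"
  proof -
    have one: "{[]} \<in> carrier B" by simp
    have "frag_of ({[0]} \<odot>\<^bsub>B\<^esub> {[]}, {[1]}) - frag_of ({[]}, {[0]} \<odot>\<^bsub>F\<^esub> {[1]}) \<in> tensor_relations \<S> B F"
      unfolding tensor_relations_def
      by (intro UnI2 CollectI exI conjI refl) (use a1 in \<open>auto simp del: One_nat_def\<close>)
    moreover have "{[0]} \<odot>\<^bsub>F\<^esub> {[1]} = ({} :: nat list set)" by (simp add: word_mult_singleton_right)
    moreover have "{[0]} \<odot>\<^bsub>B\<^esub> {[]} = ({[0]} :: nat list set)" using word_mult_Nil(2)[of "{[0]}"] by simp
    ultimately have 1: "?u - frag_of ({[]}, {}) \<in> tensor_null \<S> B F"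
      unfolding tensor_null_def by (metis generate.incl)
    have zero: "{} \<in> carrier F" unfolding F_carrier by simp
    \<comment> \<open>The additivity relation for 0 + 0 = 0 makes 1 \<otimes> 0 vanish.\<close>
    have "frag_of ({[]}, {} \<oplus>\<^bsub>F\<^esub> {}) - frag_of ({[]}, {}) - frag_of ({[]}, {}) \<in> tensor_relations \<S> B F"
      unfolding tensor_relations_def using zero one by blast
    then have "- frag_of ({[]}, {}) \<in> tensor_null \<S> B F"
      unfolding tensor_null_def by (simp add: generate.incl)
    from tensor_null_facts(4)[OF B F this] 1 show ?thesis
      using tensor_null_facts(3)[OF B F 1, of "frag_of ({[]}, {})"] by simp
  qed
  moreover have "Poly_Mapping.keys ?u \<subseteq> carrier A \<times> carrier F" using a0 a1 by simp
  ultimately have u: "?u \<in> tensor_null \<S> A F"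
    using flat_module_inj[OF flat A B i] unfolding inj_on_tensor_map_iff[OF i A B F] by simp
  \<comment> \<open>The product of the coefficients of a_0 in \<open>a\<close> and of a_1 in
    \<open>x\<close>, written as the element 0 or 1 of S. Moving \<open>r\<close> across multiplies
    either coefficient by the constant term of \<open>r\<close>, so \<open>f\<close> is balanced;
    its value on a_0 \<otimes> a_1 is 1.\<close>
  define f where "f a x = (if [0] \<in> a \<and> [1] \<in> x then {[]} else {} :: nat list set)"
    for a x :: "nat list set"
  have f_ind: "ind (f a x) w = of_bool (w = []) * (ind a [0] * ind x [1])" for a x w
    by (auto simp: f_def ind_def)
  have f_cong: "f a x = f b y" if "ind a [0] * ind x [1] = ind b [0] * ind y [1]" for a b x y
    by (rule ind_eqI) (simp only: f_ind that)
  interpret S: ring \<S> by (rule ring_word_algebra)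
  have "f {[0]} {[1]} = \<one>\<^bsub>add_monoid \<S>\<^esub>"
  proof (rule tensor_null_balanced[OF A F S.a_comm_group _ _ _ _ a0 a1 u])
    fix r a x assume r: "r \<in> carrier \<S>" and a: "a \<in> carrier A" and x: "x \<in> carrier F"
    have "ind (word_mult a r) [0] = ind a [0] * ind r []"
      using r A_S[OF a] by (simp add: ind_word_mult_letter) (simp add: ind_def)
    moreover have "ind (word_mult r x) [1] = ind r [] * ind x [1]"
      using r F_S[OF x] by (simp add: ind_word_mult_letter) (simp add: ind_def)
    ultimately show "f (r \<odot>\<^bsub>A\<^esub> a) x = f a (r \<odot>\<^bsub>F\<^esub> x)"
      by (intro f_cong) (simp only: A_simps F_simps mult.assoc)
  next
    fix a b x
    show "f (a \<oplus>\<^bsub>A\<^esub> b) x = f a x \<otimes>\<^bsub>add_monoid \<S>\<^esub> f b x"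
      by (rule ind_eqI) (simp only: f_ind ind_sym_diff A_simps word_algebra_simps monoid.simps distrib_left distrib_right)
  next
    fix a x y
    show "f a (x \<oplus>\<^bsub>F\<^esub> y) = f a x \<otimes>\<^bsub>add_monoid \<S>\<^esub> f a y"
      by (rule ind_eqI) (simp only: f_ind ind_sym_diff F_simps word_algebra_simps monoid.simps distrib_left distrib_right)
  qed (simp add: f_def)
  then show False by (simp add: f_def)
qed

section \<open>The complex of injective modules\<close>

text \<open>A group of exponent 2 is a vector space over F_2, so this extends a linear functional
  from a subspace. It is the source of the injectivity of dual modules.\<close>

lemma extend_additive_to_bit:
  fixes \<gamma> :: "'a \<Rightarrow> bit"
  assumes A: "abelian_group A" and B: "abelian_group B"
    and double: "\<And>y. y \<in> carrier B \<Longrightarrow> y \<oplus>\<^bsub>B\<^esub> y = \<zero>\<^bsub>B\<^esub>"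
    and i: "i \<in> carrier A \<rightarrow> carrier B" "inj_on i (carrier A)"
      "\<And>x y. x \<in> carrier A \<Longrightarrow> y \<in> carrier A \<Longrightarrow> i (x \<oplus>\<^bsub>A\<^esub> y) = i x \<oplus>\<^bsub>B\<^esub> i y"
    and \<gamma>: "\<And>x y. x \<in> carrier A \<Longrightarrow> y \<in> carrier A \<Longrightarrow> \<gamma> (x \<oplus>\<^bsub>A\<^esub> y) = \<gamma> x + \<gamma> y"
  obtains \<delta> :: "'b \<Rightarrow> bit" where
    "\<And>x y. x \<in> carrier B \<Longrightarrow> y \<in> carrier B \<Longrightarrow> \<delta> (x \<oplus>\<^bsub>B\<^esub> y) = \<delta> x + \<delta> y"
    "\<And>x. x \<in> carrier A \<Longrightarrow> \<delta> (i x) = \<gamma> x"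
proof (cases "\<forall>x\<in>carrier A. \<gamma> x = 0")
  case True
  then show ?thesis using that[of "\<lambda>_. 0"] by simp
next
  case False
  interpret A: abelian_group A by fact
  interpret B: abelian_group B by fact
  obtain x\<^sub>0 where x\<^sub>0: "x\<^sub>0 \<in> carrier A" "\<gamma> x\<^sub>0 = 1" using False by auto
  define t where "t = i x\<^sub>0"
  have t: "t \<in> carrier B" using i(1) x\<^sub>0 by (auto simp: t_def)
  have cancel: "(y \<oplus>\<^bsub>B\<^esub> z) \<oplus>\<^bsub>B\<^esub> z = y" "y \<oplus>\<^bsub>B\<^esub> (y \<oplus>\<^bsub>B\<^esub> z) = z" if "y \<in> carrier B" "z \<in> carrier B" for y z
    using that double by (simp_all add: B.a_assoc flip: B.a_assoc[of y y])
  \<comment> \<open>A subgroup maximal among those that contain \<open>i ` ?ker\<close> but not \<open>t\<close> has index 2; it becomes the kernel of \<open>\<delta>\<close>.\<close>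
  let ?ker = "{x \<in> carrier A. \<gamma> x = 0}"
  define \<K> where "\<K> = {K. K \<subseteq> carrier B \<and> i ` ?ker \<subseteq> K \<and> (\<forall>x\<in>K. \<forall>y\<in>K. x \<oplus>\<^bsub>B\<^esub> y \<in> K) \<and> t \<notin> K}"
  have "i ` ?ker \<in> \<K>"
  proof -
    have "i x \<oplus>\<^bsub>B\<^esub> i y \<in> i ` ?ker" if "x \<in> ?ker" "y \<in> ?ker" for x y
      using that \<gamma>[of x y] i(3)[of x y, symmetric] by (auto intro!: imageI)
    moreover have "t \<notin> i ` ?ker" using i(2) x\<^sub>0 by (auto simp: t_def inj_on_eq_iff)
    ultimately show ?thesis using i(1) by (auto simp: \<K>_def)
  qed
  then have "\<exists>M\<in>\<K>. \<forall>X\<in>\<K>. M \<subseteq> X \<longrightarrow> X = M"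
  proof (intro subset_Zorn_nonempty)
    fix \<C> assume \<C>: "\<C> \<noteq> {}" "subset.chain \<K> \<C>"
    have "x \<oplus>\<^bsub>B\<^esub> y \<in> \<Union> \<C>" if xy: "x \<in> X" "y \<in> Y" "X \<in> \<C>" "Y \<in> \<C>" for x y X Y
    proof -
      have "X \<subseteq> Y \<or> Y \<subseteq> X" using \<C>(2) xy by (auto simp: subset_chain_def)
      then obtain Z where "Z \<in> \<C>" "x \<in> Z" "y \<in> Z" using xy by blast
      moreover from this have "Z \<in> \<K>" using \<C>(2) by (auto simp: subset_chain_def)
      ultimately show ?thesis unfolding \<K>_def by blast
    qed
    then have "\<forall>x\<in>\<Union> \<C>. \<forall>y\<in>\<Union> \<C>. x \<oplus>\<^bsub>B\<^esub> y \<in> \<Union> \<C>" by blast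
    moreover have "X \<in> \<K>" if "X \<in> \<C>" for X using \<C>(2) that by (auto simp: subset_chain_def)
    then have "X \<subseteq> carrier B" "i ` ?ker \<subseteq> X" "t \<notin> X" if "X \<in> \<C>" for X
      using that unfolding \<K>_def by blast+
    then have "\<Union> \<C> \<subseteq> carrier B" "i ` ?ker \<subseteq> \<Union> \<C>" "t \<notin> \<Union> \<C>" using \<C>(1) by blast+
    ultimately show "\<Union> \<C> \<in> \<K>" unfolding \<K>_def by blast
  qed auto
  then obtain M where M: "M \<in> \<K>" and max: "\<And>X. X \<in> \<K> \<Longrightarrow> M \<subseteq> X \<Longrightarrow> X = M" by blast
  have M_sub: "M \<subseteq> carrier B" and M_ker: "\<And>x. x \<in> ?ker \<Longrightarrow> i x \<in> M"
    and M_add: "\<And>x y. x \<in> M \<Longrightarrow> y \<in> M \<Longrightarrow> x \<oplus>\<^bsub>B\<^esub> y \<in> M" and M_t: "t \<notin> M"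
    using M unfolding \<K>_def by blast+
  have M_zero: "\<zero>\<^bsub>B\<^esub> \<in> M"
  proof -
    have "i x\<^sub>0 \<oplus>\<^bsub>B\<^esub> i x\<^sub>0 \<in> M"
      using M_ker[of "x\<^sub>0 \<oplus>\<^bsub>A\<^esub> x\<^sub>0"] x\<^sub>0 \<gamma>[of x\<^sub>0 x\<^sub>0] i(3)[of x\<^sub>0 x\<^sub>0] by simp
    then show ?thesis using double[OF t] by (simp add: t_def)
  qed
  \<comment> \<open>For \<open>y\<close> outside \<open>M\<close>, the union of M and y + M is a
    larger subgroup because y + y = 0. By maximality it contains \<open>t\<close>, so t = y + m and
    hence y + t = m for some m in M.\<close>
  have M_t_add: "y \<oplus>\<^bsub>B\<^esub> t \<in> M" if y: "y \<in> carrier B" "y \<notin> M" for y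
  proof -
    have mB: "m \<in> carrier B" if "m \<in> M" for m using that M_sub by blast
    let ?X = "M \<union> (\<lambda>m. y \<oplus>\<^bsub>B\<^esub> m) ` M"
    have "y \<in> ?X" using M_zero y by (auto intro!: image_eqI[of _ _ "\<zero>\<^bsub>B\<^esub>"])
    then have "?X \<notin> \<K>" using max[of ?X] y by blast
    moreover have "?X \<subseteq> carrier B" using mB y by auto
    moreover have "i ` ?ker \<subseteq> ?X" using M_ker by blast
    moreover have "p \<oplus>\<^bsub>B\<^esub> q \<in> ?X" if "p \<in> ?X" "q \<in> ?X" for p q
    proof -
      have 1: "m \<oplus>\<^bsub>B\<^esub> (y \<oplus>\<^bsub>B\<^esub> n) = y \<oplus>\<^bsub>B\<^esub> (m \<oplus>\<^bsub>B\<^esub> n)" if "m \<in> M" "n \<in> M" for m n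
        using B.a_lcomm[of m y n] mB that y by simp
      have 2: "(y \<oplus>\<^bsub>B\<^esub> m) \<oplus>\<^bsub>B\<^esub> n = y \<oplus>\<^bsub>B\<^esub> (m \<oplus>\<^bsub>B\<^esub> n)" if "m \<in> M" "n \<in> M" for m n
        using B.a_assoc[of y m n] mB that y by simp
      have 3: "(y \<oplus>\<^bsub>B\<^esub> m) \<oplus>\<^bsub>B\<^esub> (y \<oplus>\<^bsub>B\<^esub> n) = m \<oplus>\<^bsub>B\<^esub> n" if "m \<in> M" "n \<in> M" for m n
        using 2[of m "y \<oplus>\<^bsub>B\<^esub> n"] B.a_assoc[of y m "y \<oplus>\<^bsub>B\<^esub> n"] 1[OF that] cancel(2)[of y "m \<oplus>\<^bsub>B\<^esub> n"] mB that y by simp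
      show ?thesis
        using that M_add by (elim UnE imageE) (auto simp: 1 2 3)
    qed
    ultimately have "t \<in> ?X" unfolding \<K>_def by blast
    then obtain m where m: "m \<in> M" "t = y \<oplus>\<^bsub>B\<^esub> m" using M_t by blast
    then have "y \<oplus>\<^bsub>B\<^esub> t = m" using cancel(2)[of y m] mB y by simp
    then show ?thesis using m by simp
  qed
  define \<delta> where "\<delta> y = (of_bool (y \<notin> M) :: bit)" for y
  show ?thesis
  proof (rule that[of \<delta>])
    fix y z assume yz: "y \<in> carrier B" "z \<in> carrier B"
    have 1: "y \<in> M" if "y \<oplus>\<^bsub>B\<^esub> z \<in> M" "z \<in> M"
      using M_add[OF that] unfolding cancel(1)[OF yz] .
    have 2: "z \<in> M" if "y \<in> M" "y \<oplus>\<^bsub>B\<^esub> z \<in> M"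
      using M_add[OF that] unfolding cancel(2)[OF yz] .
    have 3: "y \<oplus>\<^bsub>B\<^esub> z \<in> M" if "y \<notin> M" "z \<notin> M"
    proof -
      have "(y \<oplus>\<^bsub>B\<^esub> t) \<oplus>\<^bsub>B\<^esub> (t \<oplus>\<^bsub>B\<^esub> z) \<in> M"
        unfolding B.a_comm[OF t yz(2)] by (intro M_add M_t_add yz that)
      then show ?thesis using cancel(2)[of t z] t yz by (simp add: B.a_assoc)
    qed
    have 4: "y \<oplus>\<^bsub>B\<^esub> z \<in> M \<longleftrightarrow> (y \<in> M \<longleftrightarrow> z \<in> M)" using 1 2 3 M_add by blast
    show "\<delta> (y \<oplus>\<^bsub>B\<^esub> z) = \<delta> y + \<delta> z"
      unfolding \<delta>_def 4 by (cases "y \<in> M"; cases "z \<in> M") simp_all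
  next
    fix x assume x: "x \<in> carrier A"
    have ix: "i x \<in> carrier B" using i(1) x by blast
    show "\<delta> (i x) = \<gamma> x"
    proof (cases "\<gamma> x = 0")
      case True
      then show ?thesis using M_ker x by (simp add: \<delta>_def)
    next
      case False
      \<comment> \<open>Both \<open>x\<close> and \<open>x\<^sub>0\<close> have value 1 under
        \<gamma>, so their sum lies in the kernel and is sent into \<open>M\<close>.\<close>
      then have "i x \<oplus>\<^bsub>B\<^esub> t \<in> M"
        using M_ker[of "x \<oplus>\<^bsub>A\<^esub> x\<^sub>0"] x x\<^sub>0 \<gamma>[of x x\<^sub>0] i(3)[of x x\<^sub>0] by (simp add: t_def)
      then have "i x \<notin> M" using M_add[of "i x" "i x \<oplus>\<^bsub>B\<^esub> t"] cancel(2)[OF ix t] M_t by auto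
      then show ?thesis using False by (simp add: \<delta>_def)
    qed
  qed
qed

text \<open>Singletons form a basis of the finite subsets of \<open>W\<close> under
  \<open>sym_diff\<close>: inserting a new element is adding its singleton.\<close>

lemma bit_additive_sum:
  fixes F :: "'a set \<Rightarrow> bit"
  assumes add: "\<And>x y. finite x \<Longrightarrow> finite y \<Longrightarrow> x \<subseteq> W \<Longrightarrow> y \<subseteq> W \<Longrightarrow> F (sym_diff x y) = F x + F y"
    and x: "finite x" "x \<subseteq> W"
  shows "F x = (\<Sum>w\<in>x. F {w})"
  using x
proof (induction x rule: finite_induct)
  case empty
  have "F {} = F {} + F {}" using add[of "{}" "{}"] by simp
  then show ?case by (cases "F {}") auto
next
  case (insert w x)
  have "sym_diff {w} x = insert w x" using insert by auto
  then show ?case using add[of "{w}" x] insert by simp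
qed

section \<open>The dual complex\<close>

text \<open>A set of reduced words, finite or not, is here a functional on \<open>\<S>\<close>, and \<open>word_action r f\<close> is
  \<open>f r = (x \<mapsto> f (r x))\<close>.\<close>

definition word_action :: "nat list set \<Rightarrow> nat list set \<Rightarrow> nat list set"
  where "word_action r f = {w. reduced w \<and> (\<Sum>v\<in>r. ind f (v @ w)) = 1}"

text \<open>The full F_2-dual of \<open>proj_complex (- n)\<close>: as the reduced words are a basis
  of S, every set of them, even an infinite one, is a functional.\<close>

definition inj_complex :: "int \<Rightarrow> (nat list set, nat list set) module"
  where "inj_complex n = \<lparr>carrier = (if n \<le> 0 then Pow (Collect reduced) else {{}}),
    mult = (\<lambda>f g. {}), one = {}, ring.zero = {}, add = sym_diff, smult = word_action\<rparr>"

text \<open>The transpose of right multiplication by a_(-n-1), which goes from degree -n-1 to degree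
  -n in the projective complex. The guard makes it zero where the target vanishes.\<close>

definition inj_diff :: "int \<Rightarrow> nat list set \<Rightarrow> nat list set"
  where "inj_diff n f = {w. n < 0 \<and> w @ [nat (- n - 1)] \<in> f}"

lemma inj_complex_simps [simp]:
  "carrier (inj_complex n) = (if n \<le> 0 then Pow (Collect reduced) else {{}})"
  "\<zero>\<^bsub>inj_complex n\<^esub> = {}" "add (inj_complex n) = sym_diff" "smult (inj_complex n) = word_action"
  by (simp_all add: inj_complex_def)

lemma ind_word_action: "ind (word_action r f) w = of_bool (reduced w) * (\<Sum>v\<in>r. ind f (v @ w))"
  unfolding word_action_def by (rule ind_Collect)

lemma word_action_subset: "word_action r f \<subseteq> Collect reduced"
  by (auto simp: word_action_def)

text \<open>If \<open>w\<close> is not reduced, then no \<open>v @ w\<close> is, and both sides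
  vanish.\<close>

lemma ind_word_action_reduced:
  assumes "f \<subseteq> Collect reduced"
  shows "ind (word_action r f) w = (\<Sum>v\<in>r. ind f (v @ w))"
proof (cases "reduced w")
  case False
  then have "ind f (v @ w) = 0" for v using assms by (auto simp: ind_def reduced_append)
  then show ?thesis by (simp add: ind_word_action)
qed (simp add: ind_word_action)

text \<open>Both sides evaluate at w to the sum of the values f(uvw). The factors are reversed as
  befits a right action: f(ba) = (fb)a.\<close>

lemma word_action_word_mult:
  assumes "finite a" "finite b" and f: "f \<subseteq> Collect reduced"
  shows "word_action (word_mult b a) f = word_action a (word_action b f)"
proof (rule ind_eqI)
  fix w
  have "(\<Sum>p\<in>word_mult b a. ind f (p @ w)) = (\<Sum>u\<in>b. \<Sum>v\<in>a. ind f ((u @ v) @ w))"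
    using assms by (intro sum_word_mult) (auto simp: ind_def reduced_append)
  also have "\<dots> = (\<Sum>v\<in>a. \<Sum>u\<in>b. ind f (u @ v @ w))" by (subst sum.swap) simp
  finally show "ind (word_action (word_mult b a) f) w = ind (word_action a (word_action b f)) w"
    by (simp only: ind_word_action_reduced[OF f] ind_word_action_reduced[OF word_action_subset])
qed

lemma inj_complex_left_module: "left_module (opposite_ring \<S>) (inj_complex n)"
proof (intro left_module.intro left_module_axioms.intro)
  show "ring (opposite_ring \<S>)" by (rule ring_opposite_ring[OF ring_word_algebra])
  show "abelian_group (inj_complex n)" by (rule abelian_group_sym_diff) auto
  have reduced: "f \<subseteq> Collect reduced" if "f \<in> carrier (inj_complex n)" for f
    using that by (auto split: if_splits)
  fix a b f g assume *: "a \<in> carrier (opposite_ring \<S>)" "b \<in> carrier (opposite_ring \<S>)"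
    "f \<in> carrier (inj_complex n)" "g \<in> carrier (inj_complex n)"
  show "a \<odot>\<^bsub>inj_complex n\<^esub> f \<in> carrier (inj_complex n)"
    using * by (auto simp: word_action_def ind_def split: if_splits)
  show "(a \<oplus>\<^bsub>opposite_ring \<S>\<^esub> b) \<odot>\<^bsub>inj_complex n\<^esub> f =
      a \<odot>\<^bsub>inj_complex n\<^esub> f \<oplus>\<^bsub>inj_complex n\<^esub> b \<odot>\<^bsub>inj_complex n\<^esub> f"
    using bit_sum_sym_diff[of a b] *(1,2)
    by (intro ind_eqI)
      (simp only: opposite_ring_simps word_algebra_simps inj_complex_simps ind_word_action ind_sym_diff distrib_left)
  show "a \<odot>\<^bsub>inj_complex n\<^esub> (f \<oplus>\<^bsub>inj_complex n\<^esub> g) =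
      a \<odot>\<^bsub>inj_complex n\<^esub> f \<oplus>\<^bsub>inj_complex n\<^esub> a \<odot>\<^bsub>inj_complex n\<^esub> g"
    by (intro ind_eqI) (simp only: inj_complex_simps ind_word_action ind_sym_diff sum.distrib distrib_left)
  show "(a \<otimes>\<^bsub>opposite_ring \<S>\<^esub> b) \<odot>\<^bsub>inj_complex n\<^esub> f = a \<odot>\<^bsub>inj_complex n\<^esub> (b \<odot>\<^bsub>inj_complex n\<^esub> f)"
    using word_action_word_mult[OF _ _ reduced[OF *(3)], of a b] *(1,2) by simp
next
  fix f assume "f \<in> carrier (inj_complex n)"
  then show "\<one>\<^bsub>opposite_ring \<S>\<^esub> \<odot>\<^bsub>inj_complex n\<^esub> f = f"
    by (auto simp: word_action_def ind_def split: if_splits)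
qed

text \<open>Homomorphisms into the dual of S correspond to additive functionals, by evaluating their
  values at 1. Extending the functional of \<open>g\<close> from \<open>A\<close> to
  \<open>B\<close> therefore extends \<open>g\<close>.\<close>

lemma inj_complex_injective: "injective_module (opposite_ring \<S>) (inj_complex n)"
proof (cases "n \<le> 0")
  case False
  then have "(\<lambda>_. {}) \<in> left_module_hom (opposite_ring \<S>) B (inj_complex n)"
    for B :: "(nat list set, (nat list set, nat list set) test) module"
    by (simp add: left_module_hom_def word_action_def ind_def)
  moreover have "g x = {}" if "g \<in> left_module_hom (opposite_ring \<S>) A (inj_complex n)" "x \<in> carrier A"
    for A :: "(nat list set, (nat list set, nat list set) test) module" and g x
    using left_module_hom_facts(1)[OF that] False by simp
  ultimately show ?thesis
    unfolding injective_module_def using inj_complex_left_module by fastforce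
next
  case n: True
  show ?thesis
    unfolding injective_module_def
  proof (intro conjI allI impI inj_complex_left_module)
    fix A B :: "(nat list set, (nat list set, nat list set) test) module" and i g
    assume *: "left_module (opposite_ring \<S>) A \<and> left_module (opposite_ring \<S>) B \<and>
      i \<in> left_module_hom (opposite_ring \<S>) A B \<and> inj_on i (carrier A) \<and>
      g \<in> left_module_hom (opposite_ring \<S>) A (inj_complex n)"
    then have i: "i \<in> left_module_hom (opposite_ring \<S>) A B" and inj: "inj_on i (carrier A)"
      and g: "g \<in> left_module_hom (opposite_ring \<S>) A (inj_complex n)" by auto
    interpret A: left_module "opposite_ring \<S>" A using * by blast
    interpret B: left_module "opposite_ring \<S>" B using * by blast
    note ih = left_module_hom_facts[OF i] and gh = left_module_hom_facts[OF g]
    \<comment> \<open>\<open>B\<close> has exponent 2 because 1 + 1 = 0 in S.\<close>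
    have double: "y \<oplus>\<^bsub>B\<^esub> y = \<zero>\<^bsub>B\<^esub>" if "y \<in> carrier B" for y
      using B.smult_l_distr[of "{[]}" "{[]}" y] B.smult_one[OF that] left_module_smult_l_null[OF B.left_module_axioms that] that
      by simp
    define \<gamma> where "\<gamma> x = ind (g x) []" for x
    obtain \<delta> :: "_ \<Rightarrow> bit" where \<delta>_add: "\<And>x y. x \<in> carrier B \<Longrightarrow> y \<in> carrier B \<Longrightarrow> \<delta> (x \<oplus>\<^bsub>B\<^esub> y) = \<delta> x + \<delta> y"
      and \<delta>_i: "\<And>x. x \<in> carrier A \<Longrightarrow> \<delta> (i x) = \<gamma> x"
    proof (rule extend_additive_to_bit[OF A.M.abelian_group_axioms B.M.abelian_group_axioms double _ inj, of \<gamma>])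
      show "i \<in> carrier A \<rightarrow> carrier B" using ih(1) by blast
      show "\<gamma> (x \<oplus>\<^bsub>A\<^esub> y) = \<gamma> x + \<gamma> y" if "x \<in> carrier A" "y \<in> carrier A" for x y
        using gh(2)[OF that] by (simp only: \<gamma>_def inj_complex_simps ind_sym_diff)
    qed (use ih(2) in auto)
    \<comment> \<open>In right-module notation h(y)(w) = \<delta>(yw): the homomorphism that
      corresponds to \<delta>.\<close>
    define h where "h y = {w. reduced w \<and> \<delta> ({w} \<odot>\<^bsub>B\<^esub> y) = 1}" for y
    have h_ind: "ind (h y) w = of_bool (reduced w) * \<delta> ({w} \<odot>\<^bsub>B\<^esub> y)" for y w
      unfolding h_def by (rule ind_Collect)
    have "h \<in> left_module_hom (opposite_ring \<S>) B (inj_complex n)"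
    proof -
      have "h (x \<oplus>\<^bsub>B\<^esub> y) = sym_diff (h x) (h y)" if xy: "x \<in> carrier B" "y \<in> carrier B" for x y
      proof (rule ind_eqI)
        fix w
        have "\<delta> ({w} \<odot>\<^bsub>B\<^esub> (x \<oplus>\<^bsub>B\<^esub> y)) = \<delta> ({w} \<odot>\<^bsub>B\<^esub> x) + \<delta> ({w} \<odot>\<^bsub>B\<^esub> y)" if "reduced w"
          using xy that by (simp add: B.smult_r_distr \<delta>_add)
        then show "ind (h (x \<oplus>\<^bsub>B\<^esub> y)) w = ind (sym_diff (h x) (h y)) w"
          unfolding ind_sym_diff h_ind by auto
      qed
      moreover have "h (r \<odot>\<^bsub>B\<^esub> y) = word_action r (h y)" if r: "r \<in> carrier \<S>" and y: "y \<in> carrier B" for r y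
      proof (rule ind_eqI)
        fix w
        have "\<delta> ({w} \<odot>\<^bsub>B\<^esub> (r \<odot>\<^bsub>B\<^esub> y)) = (\<Sum>v\<in>r. ind (h y) (v @ w))" if w: "reduced w"
        proof -
          \<comment> \<open>Here h(yr)(w) = \<delta>(yrw). Expanding rw into words by additivity
            gives the action of \<open>r\<close> on h(y).\<close>
          have "\<delta> ({w} \<odot>\<^bsub>B\<^esub> (r \<odot>\<^bsub>B\<^esub> y)) = \<delta> (word_mult r {w} \<odot>\<^bsub>B\<^esub> y)"
            using B.smult_assoc1[of "{w}" r y] r w y by simp
          also have "\<dots> = (\<Sum>p\<in>word_mult r {w}. \<delta> ({p} \<odot>\<^bsub>B\<^esub> y))"
          proof (rule bit_additive_sum[of "Collect reduced"])
            fix a b assume "finite a" "finite b" "a \<subseteq> Collect reduced" "b \<subseteq> Collect reduced"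
            then show "\<delta> (sym_diff a b \<odot>\<^bsub>B\<^esub> y) = \<delta> (a \<odot>\<^bsub>B\<^esub> y) + \<delta> (b \<odot>\<^bsub>B\<^esub> y)"
              using B.smult_l_distr[of a b y] y by (simp add: \<delta>_add)
          qed (use r word_mult_closed in auto)
          also have "\<dots> = (\<Sum>p\<in>word_mult r {w}. ind (h y) p)"
            by (rule sum.cong) (auto simp: h_ind dest: word_mult_reduced)
          also have "\<dots> = (\<Sum>v\<in>r. \<Sum>w'\<in>{w}. ind (h y) (v @ w'))"
            using r by (intro sum_word_mult) (auto simp: h_ind)
          also have "\<dots> = (\<Sum>v\<in>r. ind (h y) (v @ w))" by (rule sum.cong) simp_all
          finally show ?thesis .
        qed
        then show "ind (h (r \<odot>\<^bsub>B\<^esub> y)) w = ind (word_action r (h y)) w"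
          unfolding ind_word_action by (auto simp: h_ind[of "r \<odot>\<^bsub>B\<^esub> y"])
      qed
      moreover have "h y \<in> carrier (inj_complex n)" for y using n by (auto simp: h_def)
      ultimately show ?thesis unfolding left_module_hom_def by simp
    qed
    moreover have "h (i x) = g x" if x: "x \<in> carrier A" for x
    proof (rule ind_eqI)
      fix w
      have gx: "g x \<subseteq> Collect reduced" using gh(1)[OF x] n by simp
      have "\<delta> ({w} \<odot>\<^bsub>B\<^esub> i x) = ind (g x) w" if w: "reduced w"
      proof -
        \<comment> \<open>The chain is h(i(x))(w) = \<gamma>(xw) = (g(x)w)(1) = g(x)(w).\<close>
        have "\<delta> ({w} \<odot>\<^bsub>B\<^esub> i x) = \<gamma> ({w} \<odot>\<^bsub>A\<^esub> x)"
          using ih(3)[of "{w}" x] \<delta>_i[of "{w} \<odot>\<^bsub>A\<^esub> x"] A.smult_closed[of "{w}" x] w x by simp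
        also have "\<dots> = ind (word_action {w} (g x)) []"
          using gh(3)[of "{w}" x] w x by (simp add: \<gamma>_def)
        finally show ?thesis by (simp add: ind_word_action)
      qed
      moreover have "ind (g x) w = 0" if "\<not> reduced w" using gx that by (auto simp: ind_def)
      ultimately show "ind (h (i x)) w = ind (g x) w" unfolding h_ind by (cases "reduced w") auto
    qed
    ultimately show "\<exists>h\<in>left_module_hom (opposite_ring \<S>) B (inj_complex n). \<forall>x\<in>carrier A. h (i x) = g x"
      by (intro bexI[of _ h] ballI)
  qed
qed

lemma inj_complex_subset: "f \<in> carrier (inj_complex n) \<Longrightarrow> f \<subseteq> Collect reduced"
  by (auto split: if_splits)

lemma inj_diff_hom: "inj_diff n \<in> left_module_hom (opposite_ring \<S>) (inj_complex n) (inj_complex (n + 1))"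
proof -
  have "inj_diff n f \<in> carrier (inj_complex (n + 1))" if "f \<in> carrier (inj_complex n)" for f
    using inj_complex_subset[OF that] by (auto simp: inj_diff_def reduced_append)
  moreover have "inj_diff n (word_action r f) = word_action r (inj_diff n f)" if "f \<in> carrier (inj_complex n)" for r f
  proof (rule ind_eqI)
    fix w
    have f: "f \<subseteq> Collect reduced" by (rule inj_complex_subset[OF that])
    then have f': "inj_diff n f \<subseteq> Collect reduced" by (auto simp: inj_diff_def reduced_append)
    have *: "ind (inj_diff n k) u = of_bool (n < 0) * ind k (u @ [nat (- n - 1)])" for k u
      by (auto simp: inj_diff_def ind_def)
    show "ind (inj_diff n (word_action r f)) w = ind (word_action r (inj_diff n f)) w"
      by (simp only: ind_word_action_reduced[OF f'] * ind_word_action_reduced[OF f] sum_distrib_left append_assoc)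
  qed
  moreover have "inj_diff n (sym_diff f g) = sym_diff (inj_diff n f) (inj_diff n g)" for f g
    by (auto simp: inj_diff_def)
  ultimately show ?thesis unfolding left_module_hom_def by (simp del: inj_complex_simps(1))
qed

text \<open>Put k = -n. For n < 0 a cocycle has no word ending in k - 1, so appending k keeps its
  words reduced and yields a preimage. For n = 0 the differential is zero, and 0 may follow every
  word.\<close>

lemma inj_cocycles:
  "{f \<in> carrier (inj_complex n). inj_diff n f = {}} = inj_diff (n - 1) ` carrier (inj_complex (n - 1))"
proof (cases "0 < n")
  case True
  then show ?thesis by (auto simp: inj_diff_def)
next
  case False
  define k where "k = nat (- n)"
  have k: "nat (- (n - 1) - 1) = k" "n < 0 \<Longrightarrow> k = Suc (nat (- n - 1))" "n - 1 < 0"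
    using False by (auto simp: k_def)
  have 1: "f \<in> inj_diff (n - 1) ` carrier (inj_complex (n - 1))"
    if f: "f \<subseteq> Collect reduced" "inj_diff n f = {}" for f
  proof -
    have "reduced (w @ [k])" if w: "w \<in> f" for w
    proof (cases w rule: rev_cases)
      case (snoc u l)
      then have "k \<noteq> Suc l"
        using f(2) w k(2) by (cases "n < 0") (auto simp: inj_diff_def k_def)
      then show ?thesis using f w snoc by (auto simp: reduced_append)
    qed simp
    then have "(\<lambda>w. w @ [k]) ` f \<in> carrier (inj_complex (n - 1))" using k(3) by auto
    moreover have "f = inj_diff (n - 1) ((\<lambda>w. w @ [k]) ` f)"
      unfolding inj_diff_def k(1) using k(3) by auto
    ultimately show ?thesis by (rule rev_image_eqI)
  qed
  have 2: "inj_diff (n - 1) g \<subseteq> Collect reduced" "inj_diff n (inj_diff (n - 1) g) = {}"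
    if g: "g \<subseteq> Collect reduced" for g
  proof -
    show "inj_diff (n - 1) g \<subseteq> Collect reduced" using g by (auto simp: inj_diff_def reduced_append)
    \<comment> \<open>Stripping first k and then k - 1 would need a word ending in a_(k-1) a_k,
      which is not reduced.\<close>
    have "\<not> reduced ((w @ [nat (- n - 1)]) @ [k])" if "n < 0" for w
      using k(2)[OF that] by (simp only: reduced_append) simp
    then show "inj_diff n (inj_diff (n - 1) g) = {}"
      using g k(1) unfolding inj_diff_def by blast
  qed
  show ?thesis using 1 2(2) False by (auto dest: 2(1)[THEN subsetD])
qed

lemma inj_acyclic: "acyclic_complex (opposite_ring \<S>) inj_complex inj_diff"
proof -
  have "inj_diff (n + 1) (inj_diff n x) = {}" if "x \<in> carrier (inj_complex n)" for n x
    using inj_cocycles[of "n + 1"] that by auto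
  then show ?thesis
    unfolding acyclic_complex_def cochain_complex_def
    using inj_complex_left_module inj_diff_hom inj_cocycles by (simp add: cocycles_def del: inj_complex_simps(1))
qed

lemma inj_bounded_above: "bounded_above inj_complex"
  unfolding bounded_above_def by (rule exI[of _ 0]) simp

lemma inj_not_contractible: "\<not> contractible_complex (opposite_ring \<S>) inj_complex inj_diff"
proof
  assume "contractible_complex (opposite_ring \<S>) inj_complex inj_diff"
  then obtain h where h: "\<And>n. h n \<in> left_module_hom (opposite_ring \<S>) (inj_complex n) (inj_complex (n - 1))"
    and eq: "\<And>n x. x \<in> carrier (inj_complex n) \<Longrightarrow> x \<ominus>\<^bsub>inj_complex n\<^esub> \<zero>\<^bsub>inj_complex n\<^esub> =
      inj_diff (n - 1) (h n x) \<oplus>\<^bsub>inj_complex n\<^esub> h (n + 1) (inj_diff n x)"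
    unfolding contractible_complex_def chain_homotopic_def by blast
  interpret J: left_module "opposite_ring \<S>" "inj_complex 0" by (rule inj_complex_left_module)
  have action: "word_action {u} f = {w. reduced w \<and> u @ w \<in> f}" for u f
    by (simp add: word_action_def ind_def del: sum_of_bool_eq)
  have h_zero: "h n {} = {}" for n
    using left_module_hom_zero[OF inj_complex_left_module inj_complex_left_module h, of n]
    by (simp only: inj_complex_simps)
  \<comment> \<open>As a functional, \<open>{[]}\<close> is \<epsilon>, the constant coefficient.
    The differential out of degree 0 is zero, so only the first summand of the homotopy is
    left.\<close>
  have "{[]} = {[]} \<ominus>\<^bsub>inj_complex 0\<^esub> \<zero>\<^bsub>inj_complex 0\<^esub>"
    using J.M.r_zero[of "{[]}"] J.M.add.inv_one by (simp add: J.M.minus_eq a_inv_def)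
  also have "\<dots> = inj_diff (0 - 1) (h 0 {[]}) \<oplus>\<^bsub>inj_complex 0\<^esub> h (0 + 1) (inj_diff 0 {[]})"
    by (rule eq) simp
  also have "inj_diff 0 {[]} = {}" by (simp add: inj_diff_def)
  finally have "inj_diff (- 1) (h 0 {[]}) = {[]}" by (simp add: h_zero)
  then have "[] \<in> inj_diff (- 1) (h 0 {[]})" by blast
  \<comment> \<open>At 1, the equation d(h \<epsilon>) = \<epsilon> says that (h \<epsilon>)(a_0) =
    1.\<close>
  then have "[0] \<in> h 0 {[]}" by (simp add: inj_diff_def)
  \<comment> \<open>Linearity gives (h \<epsilon>) a_0 = h(\<epsilon> a_0) = 0, whose value at 1 is
    again (h \<epsilon>)(a_0).\<close>
  moreover have "word_action {[0]} (h 0 {[]}) = h 0 (word_action {[0]} {[]})"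
    using left_module_hom_facts(3)[OF h[of 0], of "{[0]}" "{[]}"] by simp
  then have "word_action {[0]} (h 0 {[]}) = {}" by (simp add: action h_zero)
  ultimately show False by (auto simp: action)
qed

theorem mainTheorem10:
  shows "\<exists>S :: (nat list set) ring. ring S \<and>
    (\<exists>(J :: int \<Rightarrow> (nat list set, nat list set) module) d.
        acyclic_complex (opposite_ring S) J d \<and> bounded_above J \<and>
        (\<forall>n. injective_module (opposite_ring S) (J n)) \<and>
        \<not> contractible_complex (opposite_ring S) J d) \<and>
    (\<exists>(F :: int \<Rightarrow> (nat list set, nat list set) module) d.
        acyclic_complex S F d \<and> bounded_below F \<and>
        (\<forall>n. flat_module S (F n)) \<and>
        \<not> pure_acyclic_complex S F d) \<and>
    (\<exists>(P :: int \<Rightarrow> (nat list set, nat list set) module) d.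
        acyclic_complex S P d \<and> bounded_below P \<and>
        (\<forall>n. finitely_generated S (P n) \<and> projective_module S (P n)) \<and>
        \<not> contractible_complex S P d)"
proof (rule exI[of _ \<S>], intro conjI)
  show "ring \<S>" by (rule ring_word_algebra)
  show "\<exists>(J :: int \<Rightarrow> (nat list set, nat list set) module) d.
      acyclic_complex (opposite_ring \<S>) J d \<and> bounded_above J \<and>
      (\<forall>n. injective_module (opposite_ring \<S>) (J n)) \<and> \<not> contractible_complex (opposite_ring \<S>) J d"
    by (intro exI[of _ inj_complex] exI[of _ inj_diff] conjI allI inj_acyclic inj_bounded_above
        inj_complex_injective inj_not_contractible)
  \<comment> \<open>The same complex serves for (b) and (c), since its terms are both flat and
    finitely generated projective.\<close>
  show "\<exists>(F :: int \<Rightarrow> (nat list set, nat list set) module) d.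
      acyclic_complex \<S> F d \<and> bounded_below F \<and> (\<forall>n. flat_module \<S> (F n)) \<and>
      \<not> pure_acyclic_complex \<S> F d"
    by (intro exI[of _ proj_complex] exI[of _ proj_diff] conjI allI proj_acyclic proj_bounded_below
        proj_complex_flat proj_not_pure_acyclic)
  show "\<exists>(P :: int \<Rightarrow> (nat list set, nat list set) module) d.
      acyclic_complex \<S> P d \<and> bounded_below P \<and>
      (\<forall>n. finitely_generated \<S> (P n) \<and> projective_module \<S> (P n)) \<and> \<not> contractible_complex \<S> P d"
    by (intro exI[of _ proj_complex] exI[of _ proj_diff] conjI allI proj_acyclic proj_bounded_below
        proj_complex_finitely_generated proj_complex_projective proj_not_contractible)
qed

end
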